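(* Let $G$ be a finite $2$-group of order $2^n$, $n\geq 3$, which is not elementary abelian. Then for every $0\leq k\leq n$, $$s_k(G)\leq s_k(D_8\times C_2^{n-3}).$$
   Context: For a finite $p$-group $G$ of order $p^n$ and $0\le k\le n$, $s_k(G)$ denotes the number of subgroups of $G$ of order $p^k$. $D_8$ is the dihedral group of order $8$ and $C_2^{m}$ is the elementary abelian $2$-group of order $2^m$. *)

theory Defs
  imports "HOL-Algebra.Algebra"
begin

definition subgroup_count :: "('a, 'b) monoid_scheme \<Rightarrow> nat \<Rightarrow> nat" where
  "subgroup_count G k = card {H. subgroup H G \<and> card H = 2 ^ k}"

definition elementary_abelian_2 :: "('a, 'b) monoid_scheme \<Rightarrow> bool" where
  "elementary_abelian_2 G \<longleftrightarrow> comm_group G \<and> (\<forall>x\<in>carrier G. x [^]\<^bsub>G\<^esub> (2::nat) = \<one>\<^bsub>G\<^esub>)"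

text \<open>Dihedral group of order 8: (i,j) stands for r^i s^j, with s r s = r^-1.\<close>
definition D8 :: "(nat \<times> nat) monoid" where
  "D8 = \<lparr>carrier = {0..<4} \<times> {0..<2},
         monoid.mult = (\<lambda>x y. ((if snd x = 0 then fst x + fst y else fst x + 4 - fst y) mod 4,
                              (snd x + snd y) mod 2)),
         one = (0, 0)\<rparr>"

definition C2pow :: "nat \<Rightarrow> nat set monoid" where
  "C2pow m = \<lparr>carrier = Pow {..<m}, monoid.mult = (\<lambda>A B. (A - B) \<union> (B - A)), one = {}\<rparr>"

end

theory Submission
  imports Defs
begin

text \<open>
  Everything is done relative to a normal subgroup \<open>N\<close> of one fixed group, so that an induction over
  quotients never changes the group. If \<open>z\<close> is a central involution modulo \<open>N\<close> and
  \<open>N' = N \<union> zN\<close>, a subgroup \<open>H \<supseteq> N\<close> either contains \<open>N'\<close>, or is an index-2 subgroup avoiding \<open>z\<close>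
  of \<open>K = HN'\<close>. Orthogonality of the \<open>\<plusminus>1\<close>-valued characters of \<open>K\<close> bounds the number of such \<open>H\<close>, for
  \<open>[K : N'] = 2^k\<close>, by \<open>2^k\<close>, and by \<open>2^(k-1)\<close> if \<open>K/N'\<close> is not elementary abelian. This bounds the numbers
  of all and of the elementary abelian subgroups of \<open>G/N\<close> by those of \<open>G/N'\<close>, and \<open>D8 \<times> C2^m\<close> attains
  both bounds. The recursion applies as long as \<open>G/N'\<close> is not elementary abelian. Otherwise squaring is a
  nonzero quadratic form on \<open>G/N'\<close>, and one has to see that its totally singular subspaces are not more
  numerous than those of the form \<open>xy\<close>, whose totally singular subspaces are the ones contained in \<open>x = 0\<close>
  or \<open>y = 0\<close>. For this, fix \<open>x\<close> with \<open>x\<^sup>2 \<notin> N\<close> and project along \<open>x\<close>: over a subspace \<open>U\<close> of the quotient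
  lies at most one totally singular subspace if \<open>U\<close> centralises \<open>x\<close>, and at most two otherwise.
\<close>

section \<open>Characters of order two\<close>

context group
begin

text \<open>Together with \<open>m_assoc\<close>, these rules cancel adjacent inverse letters in
  right-associated words; the commutator identities below are checked this way.\<close>

lemma inv_mult_cancel:
  assumes "x \<in> carrier G" "y \<in> carrier G"
  shows "inv x \<otimes> (x \<otimes> y) = y" "x \<otimes> (inv x \<otimes> y) = y"
  using assms by (simp_all add: m_assoc[symmetric])

text \<open>
  Kernels of the homomorphisms \<open>K \<rightarrow> {\<plusminus>1}\<close> that are trivial on \<open>N\<close>: the group \<open>K\<close> itself and its index-2
  subgroups containing \<open>N\<close>.
\<close>

definition chars :: "'a set \<Rightarrow> 'a set \<Rightarrow> 'a set set" where
  "chars K N = {L. N \<subseteq> L \<and> L \<subseteq> K \<and> (\<forall>x\<in>K. \<forall>y\<in>K. x \<otimes> y \<in> L \<longleftrightarrow> (x \<in> L \<longleftrightarrow> y \<in> L))}"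

text \<open>Formed as a plain union, without conditions on \<open>z\<close>. If \<open>z\<close> is
  a central involution modulo \<open>N\<close>, then for subgroups \<open>H\<close> between
  \<open>N\<close> and \<open>Y\<close> it is the subgroup generated by \<open>H\<close> and
  \<open>z\<close> (see \<open>adj_subgroup\<close>), and \<open>adj z N\<close> is the next normal
  subgroup \<open>N'\<close>.\<close>

definition adj :: "'a \<Rightarrow> 'a set \<Rightarrow> 'a set" where
  "adj z H = H \<union> (\<lambda>h. z \<otimes> h) ` H"

text \<open>Stands for the subgroups of order \<open>2^k\<close> of \<open>Y/N\<close>.\<close>

definition psubs :: "'a set \<Rightarrow> 'a set \<Rightarrow> nat \<Rightarrow> 'a set set" where
  "psubs Y N k = {H. subgroup H G \<and> N \<subseteq> H \<and> H \<subseteq> Y \<and> card H = 2 ^ k * card N}"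

text \<open>For subgroups \<open>N \<subseteq> K\<close> this expresses that \<open>K/N\<close> is
  elementary abelian: normality and commutativity follow in \<open>sq_in_normal\<close> and
  \<open>sq_in_comm\<close>.\<close>

definition sq_in :: "'a set \<Rightarrow> 'a set \<Rightarrow> bool" where
  "sq_in K N \<longleftrightarrow> (\<forall>x\<in>K. x \<otimes> x \<in> N)"

lemma charsD:
  assumes "L \<in> chars K N"
  shows "N \<subseteq> L" "L \<subseteq> K" "\<And>x y. x \<in> K \<Longrightarrow> y \<in> K \<Longrightarrow> x \<otimes> y \<in> L \<longleftrightarrow> (x \<in> L \<longleftrightarrow> y \<in> L)"
  using assms by (auto simp: chars_def)

lemma psubsD:
  assumes "H \<in> psubs Y N k"
  shows "subgroup H G" "N \<subseteq> H" "H \<subseteq> Y" "card H = 2 ^ k * card N"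
  using assms by (auto simp: psubs_def)

lemma finite_chars: "finite K \<Longrightarrow> finite (chars K N)"
  by (rule finite_subset[of _ "Pow K"]) (auto simp: chars_def)

lemma finite_psubs: "finite Y \<Longrightarrow> finite (psubs Y N k)"
  by (rule finite_subset[of _ "Pow Y"]) (auto simp: psubs_def)

lemma chars_self:
  assumes "subgroup K G" "N \<subseteq> K"
  shows "K \<in> chars K N"
  using assms by (auto simp: chars_def subgroup.m_closed)

lemma square_in_char:
  assumes "L \<in> chars K N" "x \<in> K"
  shows "x \<otimes> x \<in> L"
  using charsD(3)[OF assms(1)] assms(2) by blast

lemma chars_subgroup:
  assumes K: "subgroup K G" and L: "L \<in> chars K N"
  shows "subgroup L G"
proof -
  have one: "\<one> \<in> L"
    using square_in_char[OF L subgroup.one_closed[OF K]] by simp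
  note c = charsD[OF L]
  show ?thesis
  proof (rule subgroupI)
    show "L \<subseteq> carrier G" using c(2) subgroup.subset[OF K] by blast
    show "L \<noteq> {}" using one by blast
    fix a assume a: "a \<in> L"
    then have "a \<in> K" using c(2) by blast
    moreover have "inv a \<in> K" using calculation K subgroup.m_inv_closed by metis
    moreover have "a \<otimes> inv a \<in> L"
      using one a calculation(1) subgroup.subset[OF K] by (simp add: subset_iff)
    ultimately show "inv a \<in> L" using a c(3) by blast
  next
    fix a b assume "a \<in> L" "b \<in> L"
    then show "a \<otimes> b \<in> L" using c by blast
  qed
qed

lemma adj_subset:
  assumes "subgroup K G" "H \<subseteq> K" "z \<in> K"
  shows "adj z H \<subseteq> K"
  using assms subgroup.m_closed[OF assms(1)] by (auto simp: adj_def)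

lemma subset_adj: "H \<subseteq> adj z H"
  by (auto simp: adj_def)

lemma mem_adj: "subgroup H G \<Longrightarrow> z \<in> carrier G \<Longrightarrow> z \<in> adj z H"
  unfolding adj_def by (metis UnI2 image_eqI r_one subgroup.one_closed)

lemma card_adj:
  assumes H: "subgroup H G" "finite H" and z: "z \<in> carrier G" "z \<notin> H"
  shows "card (adj z H) = 2 * card H"
proof -
  have sub: "H \<subseteq> carrier G" by (rule subgroup.subset[OF H(1)])
  have "inj_on (\<lambda>h. z \<otimes> h) H"
    using inj_on_cmult[OF z(1)] sub inj_on_subset by blast
  then have "card ((\<lambda>h. z \<otimes> h) ` H) = card H" by (rule card_image)
  moreover have "H \<inter> (\<lambda>h. z \<otimes> h) ` H = {}"
  proof (rule ccontr)
    assume "H \<inter> (\<lambda>h. z \<otimes> h) ` H \<noteq> {}"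
    then obtain h where h: "h \<in> H" "z \<otimes> h \<in> H" by blast
    then have "(z \<otimes> h) \<otimes> inv h \<in> H"
      using H(1) by (meson subgroup.m_closed subgroup.m_inv_closed)
    then have "z \<in> H" using h sub z by (auto simp: m_assoc subset_iff)
    then show False using z by blast
  qed
  ultimately show ?thesis
    using H by (simp add: adj_def card_Un_disjoint)
qed

text \<open>There are only two cosets: \<open>inv z\<close> lies outside \<open>L\<close>, so its
  product with any \<open>y\<close> outside \<open>L\<close> falls into \<open>L\<close>.\<close>

lemma char_adj:
  assumes K: "subgroup K G" and L: "L \<in> chars K N" and z: "z \<in> K" "z \<notin> L"
  shows "adj z L = K"
proof
  show "adj z L \<subseteq> K" using adj_subset[OF K charsD(2)[OF L] z(1)] .
  show "K \<subseteq> adj z L"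
  proof
    fix y assume y: "y \<in> K"
    have zi: "inv z \<in> K" using K z(1) subgroup.m_inv_closed by metis
    have "inv z \<notin> L"
      using chars_subgroup[OF K L] z subgroup.m_inv_closed subgroup.subset[OF K] inv_inv
      by (metis subsetD)
    then have "y \<in> L \<or> inv z \<otimes> y \<in> L"
      using charsD(3)[OF L zi y] by blast
    moreover have "y = z \<otimes> (inv z \<otimes> y)"
      using y z subgroup.subset[OF K] by (simp add: m_assoc[symmetric] subset_iff)
    ultimately show "y \<in> adj z L" unfolding adj_def by blast
  qed
qed

lemma card_char:
  assumes K: "subgroup K G" "finite K" and L: "L \<in> chars K N" and "L \<noteq> K"
  shows "card K = 2 * card L"
proof -
  obtain z where z: "z \<in> K" "z \<notin> L"
    using assms(4) charsD(2)[OF L] by blast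
  have "finite L" using K charsD(2)[OF L] finite_subset by blast
  then show ?thesis
    using card_adj[OF chars_subgroup[OF K(1) L]] char_adj[OF K(1) L z] z subgroup.subset[OF K(1)]
    by (metis subsetD)
qed

text \<open>Since \<open>H\<close> and its coset of \<open>z\<close> exhaust \<open>adj z H\<close>,
  membership in \<open>H\<close> behaves like parity. The case to check is \<open>x\<close>,
  \<open>y\<close> both outside \<open>H\<close>: from \<open>x = z \<otimes> a\<close> and
  \<open>x \<otimes> y = z \<otimes> c\<close> one gets \<open>a \<otimes> y = c\<close>, which
  would put \<open>y\<close> into \<open>H\<close>.\<close>

lemma charI:
  assumes H: "subgroup H G" "N \<subseteq> H" and z: "z \<in> carrier G" "z \<notin> H"
    and K: "subgroup (adj z H) G"
  shows "H \<in> chars (adj z H) N"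
proof -
  have sub: "H \<subseteq> carrier G" by (rule subgroup.subset[OF H(1)])
  have *: "x \<in> H" if "x \<otimes> y \<in> H" "y \<in> H" "x \<in> carrier G" for x y
  proof -
    have "(x \<otimes> y) \<otimes> inv y \<in> H"
      using that H(1) by (meson subgroup.m_closed subgroup.m_inv_closed)
    then show ?thesis using that sub by (simp add: m_assoc subset_iff)
  qed
  have **: "y \<in> H" if "x \<otimes> y \<in> H" "x \<in> H" "y \<in> carrier G" for x y
  proof -
    have "inv x \<otimes> (x \<otimes> y) \<in> H"
      using that H(1) by (meson subgroup.m_closed subgroup.m_inv_closed)
    then show ?thesis using that sub by (simp add: m_assoc[symmetric] subset_iff)
  qed
  have "x \<otimes> y \<in> H" if xy: "x \<in> adj z H" "y \<in> adj z H" "x \<notin> H" "y \<notin> H" for x y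
  proof (rule ccontr)
    assume n: "x \<otimes> y \<notin> H"
    have "x \<otimes> y \<in> adj z H" using K xy subgroup.m_closed by metis
    then obtain c where c: "c \<in> H" "x \<otimes> y = z \<otimes> c" using n by (auto simp: adj_def)
    obtain a where a: "a \<in> H" "x = z \<otimes> a" using xy by (auto simp: adj_def)
    have y: "y \<in> carrier G" using xy subgroup.subset[OF K] by blast
    have "z \<otimes> (a \<otimes> y) = z \<otimes> c" using a c y z sub by (simp add: m_assoc subset_iff)
    then have "a \<otimes> y = c" using a c y z sub by (simp add: subset_iff)
    then show False using ** a c y xy by blast
  qed
  then show ?thesis
    unfolding chars_def using H subset_adj * ** subgroup.m_closed[OF H(1)] subgroup.subset[OF K]
    by (smt (verit, best) mem_Collect_eq subsetD)
qed

text \<open>The set where two sign characters agree is the kernel of their product, so this is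
  multiplication in the character group.\<close>

lemma chars_toggle:
  assumes K: "subgroup K G" "N \<subseteq> K" and L: "L \<in> chars K N" and M: "M \<in> chars K N"
  shows "{y \<in> K. y \<in> L \<longleftrightarrow> y \<in> M} \<in> chars K N"
proof -
  have "x \<otimes> y \<in> K" if "x \<in> K" "y \<in> K" for x y
    using K that by (simp add: subgroup.m_closed)
  then show ?thesis
    using charsD[OF L] charsD[OF M] K(2) unfolding chars_def by auto
qed

text \<open>Multiplication by the character with kernel \<open>M\<close> is an involution on
  \<open>chars K N\<close> that flips the value at \<open>x\<close>.\<close>

lemma card_chars_half:
  assumes K: "subgroup K G" "finite K" "N \<subseteq> K" and M: "M \<in> chars K N" and x: "x \<in> K" "x \<notin> M"
  shows "card {L \<in> chars K N. x \<in> L} = card {L \<in> chars K N. x \<notin> L}"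
proof -
  let ?t = "\<lambda>L. {y \<in> K. y \<in> L \<longleftrightarrow> y \<in> M}"
  have t: "?t (?t L) = L" if "L \<in> chars K N" for L
    using charsD(2)[OF that] by auto
  have "bij_betw ?t {L \<in> chars K N. x \<in> L} {L \<in> chars K N. x \<notin> L}"
    by (rule bij_betwI[where g = ?t])
      (use chars_toggle[OF K(1,3) _ M] t x in auto)
  then show ?thesis by (rule bij_betw_same_card)
qed

lemma card_chars_not_mem:
  assumes K: "subgroup K G" "finite K" "N \<subseteq> K" and M: "M \<in> chars K N" and x: "x \<in> K" "x \<notin> M"
  shows "2 * card {L \<in> chars K N. x \<notin> L} = card (chars K N)"
proof -
  have "chars K N = {L \<in> chars K N. x \<in> L} \<union> {L \<in> chars K N. x \<notin> L}" by blast
  then have "card (chars K N) = card {L \<in> chars K N. x \<in> L} + card {L \<in> chars K N. x \<notin> L}"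
    using finite_chars[OF K(2)] card_Un_disjoint[of "{L \<in> chars K N. x \<in> L}" "{L \<in> chars K N. x \<notin> L}"]
    by (metis (no_types, lifting) disjoint_iff finite_Un mem_Collect_eq)
  then show ?thesis using card_chars_half[OF assms] by simp
qed

text \<open>Orthogonality: sum the signs \<open>\<plusminus>1\<close> of \<open>x \<in> L\<close> over all pairs in both orders.\<close>

lemma card_chars_times_kernel:
  assumes K: "subgroup K G" "finite K" "N \<subseteq> K"
  shows "card (chars K N) * card {x \<in> K. \<forall>L\<in>chars K N. x \<in> L} = card K"
proof -
  \<comment> \<open>\<open>?s L\<close> is the sign character of \<open>K\<close> with kernel
    \<open>L\<close>; \<open>?Z\<close> is the common kernel of all these characters.\<close>
  let ?s = "\<lambda>L x. if x \<in> L then 1 else (- 1 :: int)"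
  let ?C = "chars K N" and ?Z = "{x \<in> K. \<forall>L\<in>chars K N. x \<in> L}"
  have finC: "finite ?C" by (rule finite_chars[OF K(2)])
  have row: "(\<Sum>x\<in>K. ?s L x) = (if L = K then int (card K) else 0)" if L: "L \<in> ?C" for L
  proof (cases "L = K")
    case False
    have sub: "L \<subseteq> K" by (rule charsD(2)[OF L])
    then have "(\<Sum>x\<in>K. ?s L x) = (\<Sum>x\<in>K - L. ?s L x) + (\<Sum>x\<in>L. ?s L x)"
      using K(2) by (rule sum.subset_diff)
    also have "\<dots> = - int (card (K - L)) + int (card L)"
      by simp
    also have "card (K - L) = card L"
      using card_char[OF K(1,2) L False] card_Diff_subset[OF finite_subset[OF sub K(2)] sub] by simp
    finally show ?thesis using False by simp
  qed simp
  have col: "(\<Sum>L\<in>?C. ?s L x) = (if x \<in> ?Z then int (card ?C) else 0)" if x: "x \<in> K" for x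
  proof (cases "x \<in> ?Z")
    case False
    then obtain M where M: "M \<in> ?C" "x \<notin> M" using x by blast
    have "(\<Sum>L\<in>?C. ?s L x) = (\<Sum>L\<in>?C \<inter> {L. x \<in> L}. 1) + (\<Sum>L\<in>?C \<inter> - {L. x \<in> L}. - 1)"
      using finC by (rule sum.If_cases)
    also have "?C \<inter> {L. x \<in> L} = {L \<in> ?C. x \<in> L}" by blast
    also have "?C \<inter> - {L. x \<in> L} = {L \<in> ?C. x \<notin> L}" by blast
    finally show ?thesis using False card_chars_half[OF K M(1) x M(2)] by (auto split: if_splits)
  qed simp
  have "int (card K) = (\<Sum>L\<in>?C. if L = K then int (card K) else 0)"
    using chars_self[OF K(1,3)] finC by simp
  also have "\<dots> = (\<Sum>L\<in>?C. \<Sum>x\<in>K. ?s L x)"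
    by (rule sum.cong) (simp_all only: row)
  also have "\<dots> = (\<Sum>x\<in>K. \<Sum>L\<in>?C. ?s L x)" by (rule sum.swap)
  also have "\<dots> = (\<Sum>x\<in>K. if x \<in> ?Z then int (card ?C) else 0)"
    by (rule sum.cong) (simp_all only: col)
  also have "\<dots> = (\<Sum>x\<in>K \<inter> {x. x \<in> ?Z}. int (card ?C))"
    using sum.inter_restrict[OF K(2), of "\<lambda>_. int (card ?C)" "{x. x \<in> ?Z}"] by simp
  also have "K \<inter> {x. x \<in> ?Z} = ?Z" by blast
  finally have "int (card K) = int (card ?C) * int (card ?Z)" by simp
  then have "int (card ?C * card ?Z) = int (card K)" by simp
  then show ?thesis using of_nat_eq_iff by blast
qed

text \<open>A commutator is a product of three squares, those of \<open>g \<otimes> h\<close>,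
  \<open>inv h \<otimes> inv g \<otimes> h\<close> and \<open>inv h\<close>. As \<open>N\<close> is
  just a subgroup here, \<open>sq_in_normal\<close> can derive normality from this.\<close>

lemma sq_in_comm:
  assumes Y: "subgroup Y G" and N: "subgroup N G" and sq: "sq_in Y N"
    and g: "g \<in> Y" and h: "h \<in> Y"
  shows "g \<otimes> h \<otimes> inv g \<otimes> inv h \<in> N"
proof -
  have c: "a \<in> carrier G" if "a \<in> Y" for a using subgroup.subset[OF Y] that by blast
  note cl = subgroup.m_closed[OF Y] subgroup.m_inv_closed[OF Y]
  have s: "a \<otimes> a \<in> N" if "a \<in> Y" for a using sq that by (simp add: sq_in_def)
  let ?u = "inv h \<otimes> inv g \<otimes> h"
  have "(g \<otimes> h) \<otimes> (g \<otimes> h) \<otimes> (?u \<otimes> ?u) \<otimes> (inv h \<otimes> inv h) \<in> N"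
    using s cl g h subgroup.m_closed[OF N] by meson
  moreover have "(g \<otimes> h) \<otimes> (g \<otimes> h) \<otimes> (?u \<otimes> ?u) \<otimes> (inv h \<otimes> inv h) = g \<otimes> h \<otimes> inv g \<otimes> inv h"
    using c[OF g] c[OF h] by (simp add: m_assoc inv_mult_cancel)
  ultimately show ?thesis by simp
qed

section \<open>Subgroups avoiding a central involution\<close>

definition normal_in :: "'a set \<Rightarrow> 'a set \<Rightarrow> bool" where
  "normal_in Y N \<longleftrightarrow> subgroup Y G \<and> subgroup N G \<and> N \<subseteq> Y \<and>
     (\<forall>g\<in>Y. \<forall>n\<in>N. g \<otimes> n \<otimes> inv g \<in> N)"

text \<open>The coset \<open>zN\<close> is a central element of order 2 of \<open>Y/N\<close>.\<close>

definition central_involution :: "'a set \<Rightarrow> 'a set \<Rightarrow> 'a \<Rightarrow> bool" where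
  "central_involution Y N z \<longleftrightarrow> normal_in Y N \<and> z \<in> Y \<and> z \<notin> N \<and> z \<otimes> z \<in> N \<and>
     (\<forall>g\<in>Y. g \<otimes> z \<otimes> inv g \<otimes> inv z \<in> N)"

lemma normal_inD:
  assumes "normal_in Y N"
  shows "subgroup Y G" "subgroup N G" "N \<subseteq> Y" "\<And>g n. g \<in> Y \<Longrightarrow> n \<in> N \<Longrightarrow> g \<otimes> n \<otimes> inv g \<in> N"
  using assms by (auto simp: normal_in_def)

lemma central_involutionD:
  assumes "central_involution Y N z"
  shows "normal_in Y N" "z \<in> Y" "z \<notin> N" "z \<otimes> z \<in> N"
    "\<And>g. g \<in> Y \<Longrightarrow> g \<otimes> z \<otimes> inv g \<otimes> inv z \<in> N"
  using assms by (auto simp: central_involution_def)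

lemma sq_in_normal:
  assumes Y: "subgroup Y G" and N: "subgroup N G" "N \<subseteq> Y" and sq: "sq_in Y N"
  shows "normal_in Y N"
  unfolding normal_in_def
proof (intro conjI ballI)
  fix g n assume g: "g \<in> Y" and n: "n \<in> N"
  have c: "g \<in> carrier G" "n \<in> carrier G"
    using g n subgroup.subset[OF Y] subgroup.subset[OF N(1)] by auto
  have "(g \<otimes> n \<otimes> inv g \<otimes> inv n) \<otimes> n \<in> N"
    using sq_in_comm[OF Y N(1) sq g] n N subgroup.m_closed by (metis subsetD)
  then show "g \<otimes> n \<otimes> inv g \<in> N" using c by (simp add: m_assoc)
qed (use assms in auto)

lemma sq_in_central_involution:
  assumes "subgroup Y G" "subgroup N G" "N \<subseteq> Y" "sq_in Y N" "z \<in> Y" "z \<notin> N"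
  shows "central_involution Y N z"
  using assms sq_in_normal sq_in_comm unfolding central_involution_def sq_in_def by blast

text \<open>The commutator of \<open>h\<close> and \<open>z\<close> lies in \<open>N\<close>;
  conjugating it by \<open>inv z\<close> keeps it in \<open>N \<subseteq> H\<close>, so it can be
  absorbed into \<open>h'\<close>.\<close>

lemma central_involution_swap:
  assumes z: "central_involution Y N z" and H: "subgroup H G" "N \<subseteq> H" "H \<subseteq> Y" and h: "h \<in> H"
  shows "\<exists>h'\<in>H. h \<otimes> z = z \<otimes> h'"
proof -
  note n = normal_inD[OF central_involutionD(1)[OF z]] and d = central_involutionD[OF z]
  have c: "a \<in> carrier G" if "a \<in> Y" for a using subgroup.subset[OF n(1)] that by blast
  let ?n = "h \<otimes> z \<otimes> inv h \<otimes> inv z"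
  have hY: "h \<in> Y" using h H(3) by blast
  have nN: "?n \<in> N" using d(5) hY by blast
  have nc: "?n \<in> carrier G" using nN n(3) c by blast
  have "inv z \<otimes> ?n \<otimes> inv (inv z) \<in> N"
    using n(4)[OF _ nN] d(2) n(1) subgroup.m_inv_closed by metis
  then have "inv z \<otimes> ?n \<otimes> z \<otimes> h \<in> H"
    using d(2) c H h subgroup.m_closed[OF H(1)] by (simp add: subset_iff)
  moreover have "h \<otimes> z = z \<otimes> (inv z \<otimes> ?n \<otimes> z \<otimes> h)"
    using c[OF hY] c[OF d(2)] by (simp add: m_assoc inv_mult_cancel)
  ultimately show ?thesis by blast
qed

lemma adj_subgroup:
  assumes z: "central_involution Y N z" and H: "subgroup H G" "N \<subseteq> H" "H \<subseteq> Y"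
  shows "subgroup (adj z H) G"
proof -
  note n = normal_inD[OF central_involutionD(1)[OF z]] and d = central_involutionD[OF z]
  have zc: "z \<in> carrier G" using d(2) subgroup.subset[OF n(1)] by blast
  have Hc: "a \<in> carrier G" if "a \<in> H" for a using subgroup.subset[OF H(1)] that by blast
  note mc = subgroup.m_closed[OF H(1)] and ic = subgroup.m_inv_closed[OF H(1)]
  have zz: "z \<otimes> z \<in> H" using d(4) H(2) by blast
  have swap: "\<exists>h'\<in>H. h \<otimes> z = z \<otimes> h'" if "h \<in> H" for h
    by (rule central_involution_swap[OF z H that])
  show ?thesis
  proof (rule subgroupI)
    show "adj z H \<subseteq> carrier G" using zc Hc by (auto simp: adj_def)
    show "adj z H \<noteq> {}" using mem_adj[OF H(1) zc] by blast
  next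
    fix a assume "a \<in> adj z H"
    then consider "a \<in> H" | h where "h \<in> H" "a = z \<otimes> h" by (auto simp: adj_def)
    then show "inv a \<in> adj z H"
    proof cases
      case 1
      then show ?thesis using ic by (simp add: adj_def)
    next
      case 2
      obtain h' where h': "h' \<in> H" "inv h \<otimes> z = z \<otimes> h'" using swap ic 2 by blast
      have "inv a = inv h \<otimes> z \<otimes> inv (z \<otimes> z)"
        using 2 zc Hc by (simp add: inv_mult_group m_assoc inv_mult_cancel)
      also have "\<dots> = z \<otimes> (h' \<otimes> inv (z \<otimes> z))"
        using h' zc Hc by (simp add: m_assoc)
      finally show ?thesis using h' mc ic zz by (auto simp: adj_def)
    qed
  next
    fix a b assume "a \<in> adj z H" "b \<in> adj z H"
    then obtain h k where h: "h \<in> H" "a = h \<or> a = z \<otimes> h" and k: "k \<in> H" "b = k \<or> b = z \<otimes> k"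
      by (auto simp: adj_def)
    obtain h' where h': "h' \<in> H" "h \<otimes> z = z \<otimes> h'" using swap h by blast
    have 1: "h \<otimes> (z \<otimes> k) = z \<otimes> (h' \<otimes> k)"
      using h' h k zc Hc by (simp add: m_assoc[symmetric])
    have 2: "z \<otimes> h \<otimes> (z \<otimes> k) = z \<otimes> z \<otimes> (h' \<otimes> k)"
      using 1 h' h k zc Hc by (simp add: m_assoc)
    have 3: "z \<otimes> h \<otimes> k = z \<otimes> (h \<otimes> k)"
      using h k zc Hc by (simp add: m_assoc)
    show "a \<otimes> b \<in> adj z H"
      using h k h' 1 2 3 mc zz by (auto simp: adj_def)
  qed
qed

text \<open>This is what lets inductions replace \<open>N\<close> by \<open>adj z N\<close>: the
  conjugate of \<open>z \<otimes> k\<close> is a commutator in \<open>N\<close> times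
  \<open>z\<close> times a conjugate of \<open>k\<close>.\<close>

lemma adj_normal_in:
  assumes z: "central_involution Y N z"
  shows "normal_in Y (adj z N)"
  unfolding normal_in_def
proof (intro conjI ballI)
  note n = normal_inD[OF central_involutionD(1)[OF z]] and d = central_involutionD[OF z]
  have c: "a \<in> carrier G" if "a \<in> Y" for a using subgroup.subset[OF n(1)] that by blast
  show "subgroup Y G" "subgroup (adj z N) G" "adj z N \<subseteq> Y"
    using n adj_subgroup[OF z n(2)] adj_subset d(2) by auto
  fix g m assume g: "g \<in> Y" and "m \<in> adj z N"
  then consider "m \<in> N" | k where "k \<in> N" "m = z \<otimes> k" by (auto simp: adj_def)
  then show "g \<otimes> m \<otimes> inv g \<in> adj z N"
  proof cases
    case 1
    then show ?thesis using n(4)[OF g] by (simp add: adj_def)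
  next
    case 2
    have kY: "k \<in> Y" using 2 n(3) by blast
    have "g \<otimes> m \<otimes> inv g = (g \<otimes> z \<otimes> inv g \<otimes> inv z) \<otimes> (z \<otimes> (g \<otimes> k \<otimes> inv g))"
      using 2 c[OF g] c[OF d(2)] c[OF kY] by (simp add: m_assoc inv_mult_cancel)
    moreover have "g \<otimes> z \<otimes> inv g \<otimes> inv z \<in> adj z N"
      using d(5)[OF g] by (simp add: adj_def)
    moreover have "z \<otimes> (g \<otimes> k \<otimes> inv g) \<in> adj z N"
      using n(4)[OF g 2(1)] by (simp add: adj_def)
    ultimately show ?thesis
      using adj_subgroup[OF z n(2)] n(3) subgroup.m_closed by (metis order_refl)
  qed
qed

lemma card_adj_central:
  assumes z: "central_involution Y N z" and "finite Y"
  shows "card (adj z N) = 2 * card N"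
proof -
  note n = normal_inD[OF central_involutionD(1)[OF z]] and d = central_involutionD[OF z]
  show ?thesis
    using card_adj[OF n(2) finite_subset[OF n(3) assms(2)] _ d(3)] d(2) subgroup.subset[OF n(1)]
    by blast
qed

text \<open>The exponent drops by one because \<open>adj z N\<close> is twice as large as
  \<open>N\<close>.\<close>

lemma psubs_containing:
  assumes z: "central_involution Y N z" and fin: "finite Y"
  shows "{H \<in> psubs Y N (Suc k). z \<in> H} = psubs Y (adj z N) k"
proof -
  have "adj z N \<subseteq> H \<longleftrightarrow> N \<subseteq> H \<and> z \<in> H" if "subgroup H G" for H
    using adj_subset[OF that] subset_adj
      mem_adj[OF normal_inD(2)[OF central_involutionD(1)[OF z]]] central_involutionD(2)[OF z]
      subgroup.subset[OF normal_inD(1)[OF central_involutionD(1)[OF z]]]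
    by blast
  then show ?thesis
    unfolding psubs_def card_adj_central[OF z fin] by auto
qed

text \<open>The exponent stays at \<open>k\<close>, since passing from \<open>H\<close> to
  \<open>adj z H\<close> and from \<open>N\<close> to \<open>adj z N\<close> doubles both orders.
  The converse is \<open>psubs_char\<close>.\<close>

lemma psubs_adj:
  assumes z: "central_involution Y N z" and fin: "finite Y"
    and H: "H \<in> psubs Y N k" "z \<notin> H"
  shows "adj z H \<in> psubs Y (adj z N) k" "H \<in> chars (adj z H) N"
proof -
  note n = normal_inD[OF central_involutionD(1)[OF z]] and d = central_involutionD[OF z]
    and h = psubsD[OF H(1)]
  have zc: "z \<in> carrier G" using d(2) subgroup.subset[OF n(1)] by blast
  have sub: "subgroup (adj z H) G" by (rule adj_subgroup[OF z h(1-3)])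
  show "H \<in> chars (adj z H) N"
    by (rule charI[OF h(1,2) zc H(2) sub])
  have "card (adj z H) = 2 * card H"
    by (rule card_adj[OF h(1) finite_subset[OF h(3) fin] zc H(2)])
  moreover have "adj z H \<subseteq> Y" by (rule adj_subset[OF n(1) h(3) d(2)])
  moreover have "adj z N \<subseteq> adj z H" using h(2) by (auto simp: adj_def)
  ultimately show "adj z H \<in> psubs Y (adj z N) k"
    unfolding psubs_def card_adj_central[OF z fin] using sub h(4) by simp
qed

lemma psubs_char:
  assumes z: "central_involution Y N z" and fin: "finite Y"
    and K: "K \<in> psubs Y (adj z N) k" and L: "L \<in> chars K N" "z \<notin> L"
  shows "L \<in> psubs Y N k" "adj z L = K"
proof -
  note n = normal_inD[OF central_involutionD(1)[OF z]] and d = central_involutionD[OF z]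
    and h = psubsD[OF K]
  have zK: "z \<in> K" using mem_adj[OF n(2)] d(2) h(2) subgroup.subset[OF n(1)] by blast
  show "adj z L = K" by (rule char_adj[OF h(1) L(1) zK L(2)])
  have "card K = 2 * card L"
    using card_char[OF h(1) finite_subset[OF h(3) fin] L(1)] zK L(2) by blast
  then show "L \<in> psubs Y N k"
    using chars_subgroup[OF h(1) L(1)] charsD[OF L(1)] h
    unfolding psubs_def card_adj_central[OF z fin] by auto
qed

text \<open>The members of \<open>F\<close> are sorted by \<open>K = adj z L\<close>, which
  \<open>L\<close> determines, so the fibres are disjoint. \<open>F\<close> is arbitrary so that the
  same count serves all subgroups, the elementary abelian ones, and later the projection along a
  non-involution \<open>x\<close>.\<close>

lemma card_not_containing:
  assumes z: "central_involution Y N z" and fin: "finite Y"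
    and F: "F \<subseteq> {H \<in> psubs Y N k. z \<notin> H}"
  shows "card F = (\<Sum>K\<in>psubs Y (adj z N) k. card {L \<in> chars K N. z \<notin> L \<and> L \<in> F})"
proof -
  let ?A = "\<lambda>K. {L \<in> chars K N. z \<notin> L \<and> L \<in> F}"
  have fA: "finite (?A K)" if "K \<in> psubs Y (adj z N) k" for K
    using finite_chars finite_subset[OF psubsD(3)[OF that] fin] by simp
  have "F = (\<Union>K\<in>psubs Y (adj z N) k. ?A K)"
  proof
    show "F \<subseteq> (\<Union>K\<in>psubs Y (adj z N) k. ?A K)"
    proof
      fix H assume H: "H \<in> F"
      then have "H \<in> psubs Y N k" "z \<notin> H" using F by auto
      note p = psubs_adj[OF z fin this]
      show "H \<in> (\<Union>K\<in>psubs Y (adj z N) k. ?A K)"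
        by (rule UN_I[OF p(1)]) (use H \<open>z \<notin> H\<close> p(2) in simp)
    qed
  qed blast
  moreover have "card (\<Union>K\<in>psubs Y (adj z N) k. ?A K) = (\<Sum>K\<in>psubs Y (adj z N) k. card (?A K))"
  proof (rule card_UN_disjoint)
    show "finite (psubs Y (adj z N) k)" by (rule finite_psubs[OF fin])
    show "\<forall>K\<in>psubs Y (adj z N) k. finite (?A K)" using fA by blast
    have "K = K'" if "K \<in> psubs Y (adj z N) k" "K' \<in> psubs Y (adj z N) k" "L \<in> ?A K" "L \<in> ?A K'" for K K' L
      using psubs_char(2)[OF z fin that(1), of L] psubs_char(2)[OF z fin that(2), of L] that(3,4) by simp
    then show "\<forall>K\<in>psubs Y (adj z N) k. \<forall>K'\<in>psubs Y (adj z N) k. K \<noteq> K' \<longrightarrow> ?A K \<inter> ?A K' = {}"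
      by blast
  qed
  ultimately show ?thesis by simp
qed

lemma card_psubs_Suc:
  assumes z: "central_involution Y N z" and fin: "finite Y"
  shows "card (psubs Y N (Suc k)) = card (psubs Y (adj z N) k) +
    (\<Sum>K\<in>psubs Y (adj z N) (Suc k). card {L \<in> chars K N. z \<notin> L})"
proof -
  let ?P = "psubs Y N (Suc k)"
  have "?P = {H \<in> ?P. z \<in> H} \<union> {H \<in> ?P. z \<notin> H}" by blast
  then have "card ?P = card {H \<in> ?P. z \<in> H} + card {H \<in> ?P. z \<notin> H}"
    using finite_psubs[OF fin] card_Un_disjoint[of "{H \<in> ?P. z \<in> H}" "{H \<in> ?P. z \<notin> H}"]
    by (metis (no_types, lifting) disjoint_iff finite_Un mem_Collect_eq)
  also have "card {H \<in> ?P. z \<notin> H} =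
      (\<Sum>K\<in>psubs Y (adj z N) (Suc k). card {L \<in> chars K N. z \<notin> L \<and> L \<in> {H \<in> ?P. z \<notin> H}})"
    by (rule card_not_containing[OF z fin]) simp
  also have "\<dots> = (\<Sum>K\<in>psubs Y (adj z N) (Suc k). card {L \<in> chars K N. z \<notin> L})"
    by (intro sum.cong refl arg_cong[where f = card]) (use psubs_char(1)[OF z fin] in auto)
  finally show ?thesis using psubs_containing[OF z fin] by simp
qed

lemma psubs_0:
  assumes "subgroup N G" "N \<subseteq> Y" "finite Y"
  shows "psubs Y N 0 = {N}"
proof -
  have "H = N" if "H \<in> psubs Y N 0" for H
  proof -
    have "finite H" by (rule finite_subset[OF psubsD(3)[OF that] assms(3)])
    then show ?thesis using card_subset_eq[of H N] psubsD[OF that] by simp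
  qed
  then show ?thesis using assms by (auto simp: psubs_def)
qed

text \<open>Characters of an elementary abelian quotient separate points: for \<open>x\<close>
  outside \<open>N\<close>, a subgroup \<open>M\<close> maximal among those containing
  \<open>N\<close> and avoiding \<open>x\<close> has index 2.\<close>

lemma kernel_sq_in:
  assumes K: "subgroup K G" "finite K" and N: "subgroup N G" "N \<subseteq> K" and sq: "sq_in K N"
  shows "{x \<in> K. \<forall>L\<in>chars K N. x \<in> L} = N"
proof (rule equalityI)
  show "N \<subseteq> {x \<in> K. \<forall>L\<in>chars K N. x \<in> L}"
    using N(2) charsD(1) by blast
  show "{x \<in> K. \<forall>L\<in>chars K N. x \<in> L} \<subseteq> N"
  proof (rule ccontr)
    assume "\<not> {x \<in> K. \<forall>L\<in>chars K N. x \<in> L} \<subseteq> N"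
    then obtain x where x: "x \<in> K" "\<And>L. L \<in> chars K N \<Longrightarrow> x \<in> L" "x \<notin> N" by blast
    have xc: "x \<in> carrier G" using x(1) subgroup.subset[OF K(1)] by blast
    let ?F = "{M. subgroup M G \<and> N \<subseteq> M \<and> M \<subseteq> K \<and> x \<notin> M}"
    have "finite ?F" by (rule finite_subset[of _ "Pow K"]) (use K(2) in auto)
    moreover have "?F \<noteq> {}" using N x(3) by blast
    ultimately have "\<exists>M\<in>?F. \<forall>M'\<in>?F. M \<subseteq> M' \<longrightarrow> M = M'" by (rule finite_has_maximal)
    then obtain M where M: "M \<in> ?F" and max: "\<And>M'. M' \<in> ?F \<Longrightarrow> M \<subseteq> M' \<Longrightarrow> M = M'"
      by (elim bexE) blast
    have Ms: "subgroup M G" "N \<subseteq> M" "M \<subseteq> K" "x \<notin> M" using M by auto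
    have Mc: "m \<in> carrier G" if "m \<in> M" for m using subgroup.subset[OF Ms(1)] that by blast
    \<comment> \<open>For \<open>y\<close> outside \<open>M\<close>, maximality forces
      \<open>x\<close> into \<open>adj y M\<close>, and solving \<open>x = y \<otimes> m\<close> for
      \<open>y\<close> puts \<open>y\<close> into \<open>adj x M\<close>.\<close>
    have "y \<in> adj x M" if y: "y \<in> K" for y
    proof (cases "y \<in> M")
      case False
      have yc: "y \<in> carrier G" using y subgroup.subset[OF K(1)] by blast
      have "central_involution K N y"
        using sq_in_central_involution[OF K(1) N sq y] False Ms(2) by blast
      then have "subgroup (adj y M) G" by (rule adj_subgroup[OF _ Ms(1-3)])
      moreover have "adj y M \<subseteq> K" by (rule adj_subset[OF K(1) Ms(3) y])
      moreover have "M \<noteq> adj y M" using mem_adj[OF Ms(1) yc] False by blast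
      ultimately have "x \<in> adj y M"
        using max[of "adj y M"] Ms(2) subset_adj[of M y] by blast
      then obtain m where m: "m \<in> M" "x = y \<otimes> m" using Ms(4) by (auto simp: adj_def)
      then have "y = x \<otimes> inv m" using yc Mc by (simp add: m_assoc)
      then show ?thesis
        using subgroup.m_inv_closed[OF Ms(1) m(1)] by (auto simp: adj_def)
    qed (simp add: adj_def)
    then have "adj x M = K" using adj_subset[OF K(1) Ms(3) x(1)] by blast
    then have "M \<in> chars K N" using charI[OF Ms(1,2) xc Ms(4)] K(1) by simp
    then show False using x(2) Ms(4) by blast
  qed
qed

text \<open>At most half of the characters are nontrivial at \<open>z\<close>, and by orthogonality
  their total number is \<open>card K\<close> divided by the order of the common kernel. That kernel
  contains \<open>N\<close>, and it has at least twice the order of \<open>N\<close> once some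
  square lies outside \<open>N\<close>.\<close>

lemma card_chars_not_mem_le:
  assumes K: "subgroup K G" "finite K" and N: "subgroup N G" "N \<subseteq> K"
    and card: "card K = 2 ^ Suc k * card N" and z: "z \<in> K"
  shows "card {L \<in> chars K N. z \<notin> L} \<le> 2 ^ k"
    and "\<not> sq_in K N \<Longrightarrow> 2 * card {L \<in> chars K N. z \<notin> L} \<le> 2 ^ k"
proof -
  let ?Z = "{x \<in> K. \<forall>L\<in>chars K N. x \<in> L}"
  let ?c = "card {L \<in> chars K N. z \<notin> L}"
  have fN: "finite N" by (rule finite_subset[OF N(2) K(2)])
  have pos: "0 < card N"
    using fN subgroup.one_closed[OF N(1)] card_gt_0_iff by blast
  have two: "2 * ?c \<le> card (chars K N)"
  proof (cases "{L \<in> chars K N. z \<notin> L} = {}")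
    case False
    then show ?thesis using card_chars_not_mem[OF K N(2) _ z] by fastforce
  qed (simp only: card.empty)
  have ker: "card (chars K N) * card ?Z = 2 ^ Suc k * card N"
    using card_chars_times_kernel[OF K N(2)] card by simp
  have NZ: "N \<subseteq> ?Z" using N(2) charsD(1) by blast
  have fZ: "finite ?Z" using K(2) by simp
  have "2 * ?c * card N \<le> card (chars K N) * card ?Z"
    using two card_mono[OF fZ NZ] by (rule mult_le_mono)
  then have "2 * ?c * card N \<le> 2 ^ Suc k * card N" using ker by simp
  then show "?c \<le> 2 ^ k" using pos by simp
  assume "\<not> sq_in K N"
  then obtain x where x: "x \<in> K" "x \<otimes> x \<notin> N" by (auto simp: sq_in_def)
  let ?w = "x \<otimes> x"
  have w: "?w \<in> K" "?w \<in> carrier G"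
    using x(1) K(1) subgroup.m_closed subgroup.subset by (metis, metis subgroup.mem_carrier subgroup.m_closed)
  \<comment> \<open>\<open>adj ?w N\<close> serves only as a set of \<open>2 * card N\<close>
    elements inside the common kernel.\<close>
  have "adj ?w N \<subseteq> ?Z"
  proof
    fix a assume a: "a \<in> adj ?w N"
    have "adj ?w N \<subseteq> L" if "L \<in> chars K N" for L
      by (rule adj_subset[OF chars_subgroup[OF K(1) that] charsD(1)[OF that] square_in_char[OF that x(1)]])
    then show "a \<in> ?Z" using a adj_subset[OF K(1) N(2) w(1)] by blast
  qed
  from card_mono[OF fZ this] have "2 * card N \<le> card ?Z"
    by (simp only: card_adj[OF N(1) fN w(2) x(2)])
  with two have "2 * ?c * (2 * card N) \<le> card (chars K N) * card ?Z"
    by (rule mult_le_mono)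
  then have "2 * ?c * (2 * card N) \<le> 2 ^ Suc k * card N" using ker by simp
  then show "2 * ?c \<le> 2 ^ k" using pos by simp
qed

lemma card_chars_not_mem_eq:
  assumes K: "subgroup K G" "finite K" and N: "subgroup N G" "N \<subseteq> K"
    and card: "card K = 2 ^ Suc k * card N" and z: "z \<in> K" "z \<notin> N" and sq: "sq_in K N"
  shows "card {L \<in> chars K N. z \<notin> L} = 2 ^ k"
proof -
  have fN: "finite N" by (rule finite_subset[OF N(2) K(2)])
  have pos: "0 < card N"
    using fN subgroup.one_closed[OF N(1)] card_gt_0_iff by blast
  obtain M where M: "M \<in> chars K N" "z \<notin> M"
    using kernel_sq_in[OF K N sq] z by blast
  have "card (chars K N) * card N = 2 ^ Suc k * card N"
    using card_chars_times_kernel[OF K N(2)] kernel_sq_in[OF K N sq] card by simp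
  then have "card (chars K N) = 2 ^ Suc k" using pos by simp
  then show ?thesis using card_chars_not_mem[OF K N(2) M(1) z(1) M(2)] by simp
qed

end

section \<open>Subgroup counts of elementary abelian quotients\<close>

text \<open>Gaussian binomial coefficients for \<open>q = 2\<close>.\<close>

fun gbinom2 :: "nat \<Rightarrow> nat \<Rightarrow> nat" where
  "gbinom2 n 0 = 1"
| "gbinom2 0 (Suc k) = 0"
| "gbinom2 (Suc n) (Suc k) = gbinom2 n k + 2 ^ Suc k * gbinom2 n (Suc k)"

context group
begin

text \<open>Every \<open>K\<close> has exactly \<open>2 ^ Suc j\<close> complements of
  \<open>z\<close>, so \<open>card_psubs_Suc\<close> becomes the defining recursion of
  \<open>gbinom2\<close>; no vector space structure is introduced.\<close>

lemma card_psubs_sq_in: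
  assumes "subgroup Y G" "finite Y" "subgroup N G" "N \<subseteq> Y" "sq_in Y N" "card Y = 2 ^ n * card N"
  shows "card (psubs Y N k) = gbinom2 n k"
  using assms(3-)
proof (induction n arbitrary: N k)
  case 0
  have NY: "N = Y" using 0 card_subset_eq[OF assms(2)] by simp
  have pos: "0 < card Y"
    using assms(1,2) subgroup.one_closed card_gt_0_iff by blast
  show ?case
  proof (cases k)
    case 0
    then show ?thesis using psubs_0[OF \<open>subgroup N G\<close> \<open>N \<subseteq> Y\<close> assms(2)] by simp
  next
    case (Suc j)
    have "psubs Y N k = {}"
    proof (rule ccontr)
      assume "psubs Y N k \<noteq> {}"
      then obtain H where "H \<in> psubs Y N k" by blast
      then have "2 ^ k * card Y \<le> card Y"
        using psubsD[of H Y N k] card_mono[OF assms(2)] NY by metis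
      moreover have "1 < (2::nat) ^ k" using Suc by (intro one_less_power) auto
      ultimately show False using pos by simp
    qed
    then show ?thesis using Suc by simp
  qed
next
  case (Suc n)
  show ?case
  proof (cases k)
    case 0
    then show ?thesis using psubs_0[OF Suc.prems(1,2) assms(2)] by simp
  next
    case (Suc j)
    have fN: "finite N" by (rule finite_subset[OF Suc.prems(2) assms(2)])
    have pos: "0 < card N"
      using fN subgroup.one_closed[OF Suc.prems(1)] card_gt_0_iff by blast
    have "N \<noteq> Y" using Suc.prems(4) pos by auto
    then obtain z where z: "z \<in> Y" "z \<notin> N" using Suc.prems(2) by blast
    have c: "central_involution Y N z"
      by (rule sq_in_central_involution[OF assms(1) Suc.prems(1-3) z])
    let ?N = "adj z N"
    note n = normal_inD[OF adj_normal_in[OF c]]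
    have sq: "sq_in Y ?N" using Suc.prems(3) subset_adj[of N z] by (auto simp: sq_in_def)
    have cN: "card ?N = 2 * card N" by (rule card_adj_central[OF c assms(2)])
    have IH: "card (psubs Y ?N i) = gbinom2 n i" for i
      by (rule Suc.IH[OF n(2,3) sq]) (simp add: cN Suc.prems(4))
    have "card {L \<in> chars K N. z \<notin> L} = 2 ^ Suc j" if K: "K \<in> psubs Y ?N (Suc j)" for K
    proof (rule card_chars_not_mem_eq)
      note p = psubsD[OF K]
      show "subgroup K G" "finite K" "subgroup N G" "z \<notin> N" using p assms(2) finite_subset Suc.prems z by auto
      show "N \<subseteq> K" using p(2) subset_adj[of N z] by blast
      show "z \<in> K" using mem_adj[OF Suc.prems(1)] z(1) p(2) subgroup.subset[OF assms(1)] by blast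
      show "card K = 2 ^ Suc (Suc j) * card N" using p(4) cN by simp
      show "sq_in K N" using Suc.prems(3) p(3) by (auto simp: sq_in_def)
    qed
    then show ?thesis
      using card_psubs_Suc[OF c assms(2), of j] IH Suc by simp
  qed
qed

end

section \<open>Upper bounds\<close>

text \<open>
  The number of \<open>k\<close>-dimensional subspaces of \<open>F\<^sub>2^(m + 2)\<close> contained in at least one of two fixed
  hyperplanes; for \<open>n = m + 3\<close>, \<open>sub_bound\<close> and \<open>elem_bound\<close> are then the numbers of all and of the
  elementary abelian subgroups of order \<open>2^k\<close> of \<open>D8 \<times> C2^m\<close>.
\<close>

fun hyp2 :: "nat \<Rightarrow> nat \<Rightarrow> nat" where
  "hyp2 m 0 = 1"
| "hyp2 0 (Suc k) = (if k = 0 then 2 else 0)"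
| "hyp2 (Suc m) (Suc k) = hyp2 m k + 2 ^ Suc k * hyp2 m (Suc k)"

fun sub_bound :: "nat \<Rightarrow> nat \<Rightarrow> nat" where
  "sub_bound m 0 = 1"
| "sub_bound m (Suc k) = gbinom2 (Suc (Suc m)) k + 2 ^ Suc k * hyp2 m (Suc k)"

fun elem_bound :: "nat \<Rightarrow> nat \<Rightarrow> nat" where
  "elem_bound m 0 = 1"
| "elem_bound m (Suc k) = hyp2 m k + 2 ^ Suc k * hyp2 m (Suc k)"

text \<open>Inclusion and exclusion: both hyperplanes have dimension \<open>m + 1\<close> and they
  meet in dimension \<open>m\<close>.\<close>

lemma hyp2_gbinom2: "hyp2 m k + gbinom2 m k = 2 * gbinom2 (Suc m) k"
proof (induction m k rule: hyp2.induct)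
  case (2 k)
  then show ?case by (cases k) auto
next
  case (3 m k)
  have "2 ^ Suc k * hyp2 m (Suc k) + 2 ^ Suc k * gbinom2 m (Suc k) = 2 * (2 ^ Suc k * gbinom2 (Suc m) (Suc k))"
    using 3(2) by (metis distrib_left mult.left_commute)
  then show ?case
    using 3(1) hyp2.simps(3)[of m k] gbinom2.simps(3)[of m k] gbinom2.simps(3)[of "Suc m" k] by linarith
qed simp

lemma gbinom2_mono: "gbinom2 m k \<le> gbinom2 (Suc m) k"
proof (cases k)
  case (Suc j)
  have "1 * gbinom2 m (Suc j) \<le> 2 ^ Suc j * gbinom2 m (Suc j)"
    by (rule mult_le_mono1) simp
  then show ?thesis unfolding Suc gbinom2.simps by linarith
qed simp

text \<open>This and \<open>elem_bound_Suc\<close> reproduce the right-hand sides of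
  \<open>card_psubs_Suc_le\<close> and \<open>card_esubs_Suc_le\<close>, which is what closes the
  induction.\<close>

lemma sub_bound_Suc:
  "sub_bound (Suc m) (Suc k) = sub_bound m k + 2 ^ k * (sub_bound m (Suc k) + elem_bound m (Suc k))"
  by (cases k) (auto simp: algebra_simps)

lemma elem_bound_Suc:
  "elem_bound (Suc m) (Suc k) = elem_bound m k + 2 ^ Suc k * elem_bound m (Suc k)"
  by (cases k) (auto simp: algebra_simps)

section \<open>Recursive bounds along a central involution\<close>

context group
begin

definition esubs :: "'a set \<Rightarrow> 'a set \<Rightarrow> nat \<Rightarrow> 'a set set" where
  "esubs Y N k = {H \<in> psubs Y N k. sq_in H N}"

text \<open>With \<open>n\<close> the commutator of \<open>h\<close> and \<open>z\<close>, the
  square of \<open>z \<otimes> h\<close> is a conjugate of \<open>n\<close> times the squares of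
  \<open>z\<close> and \<open>h\<close>.\<close>

lemma adj_sq_in:
  assumes z: "central_involution Y N z" and H: "subgroup H G" "H \<subseteq> Y" "sq_in H N"
  shows "sq_in (adj z H) N"
  unfolding sq_in_def
proof
  note n = normal_inD[OF central_involutionD(1)[OF z]] and d = central_involutionD[OF z]
  have c: "a \<in> carrier G" if "a \<in> Y" for a using subgroup.subset[OF n(1)] that by blast
  fix a assume "a \<in> adj z H"
  then consider "a \<in> H" | h where "h \<in> H" "a = z \<otimes> h" by (auto simp: adj_def)
  then show "a \<otimes> a \<in> N"
  proof cases
    case 1
    then show ?thesis using H(3) by (simp add: sq_in_def)
  next
    case 2
    let ?n = "h \<otimes> z \<otimes> inv h \<otimes> inv z"
    have hY: "h \<in> Y" using 2 H by blast
    have "z \<otimes> ?n \<otimes> inv z \<in> N" using n(4)[OF d(2) d(5)[OF hY]] .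
    moreover have "h \<otimes> h \<in> N" using H(3) 2 by (simp add: sq_in_def)
    ultimately have "(z \<otimes> ?n \<otimes> inv z) \<otimes> (z \<otimes> z) \<otimes> (h \<otimes> h) \<in> N"
      using d(4) subgroup.m_closed[OF n(2)] by blast
    moreover have "(z \<otimes> ?n \<otimes> inv z) \<otimes> (z \<otimes> z) \<otimes> (h \<otimes> h) = a \<otimes> a"
      using 2 c[OF hY] c[OF d(2)] by (simp add: m_assoc inv_mult_cancel)
    ultimately show ?thesis by simp
  qed
qed

lemma central_involution_mem:
  assumes z: "central_involution Y N z" and K: "K \<in> psubs Y (adj z N) k"
  shows "z \<in> K" "N \<subseteq> K"
proof -
  note n = normal_inD[OF central_involutionD(1)[OF z]]
  show "z \<in> K"
    using mem_adj[OF n(2)] central_involutionD(2)[OF z] psubsD(2)[OF K] subgroup.subset[OF n(1)] by blast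
  show "N \<subseteq> K" using psubsD(2)[OF K] subset_adj[of N z] by blast
qed

lemma psubs_chars_le:
  assumes z: "central_involution Y N z" and fin: "finite Y" and K: "K \<in> psubs Y (adj z N) k"
  shows "card {L \<in> chars K N. z \<notin> L} \<le> 2 ^ k"
    and "\<not> sq_in K N \<Longrightarrow> 2 * card {L \<in> chars K N. z \<notin> L} \<le> 2 ^ k"
proof -
  note n = normal_inD[OF central_involutionD(1)[OF z]] and p = psubsD[OF K]
    and zN = central_involution_mem[OF z K]
  have "finite K" by (rule finite_subset[OF p(3) fin])
  moreover have "card K = 2 ^ Suc k * card N"
    using p(4) card_adj_central[OF z fin] by simp
  ultimately show "card {L \<in> chars K N. z \<notin> L} \<le> 2 ^ k"
    and "\<not> sq_in K N \<Longrightarrow> 2 * card {L \<in> chars K N. z \<notin> L} \<le> 2 ^ k"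
    using card_chars_not_mem_le[OF p(1) _ n(2) zN(2) _ zN(1)] by blast+
qed

text \<open>Each \<open>K\<close> has at most \<open>2 ^ Suc k\<close> complements of
  \<open>z\<close>, and at most half as many if it is not elementary abelian modulo
  \<open>adj z N\<close>, hence not modulo \<open>N\<close>. So \<open>K\<close> counts
  \<open>2 ^ k\<close> once, and a second time if it lies in \<open>esubs\<close>.\<close>

lemma card_psubs_Suc_le:
  assumes z: "central_involution Y N z" and fin: "finite Y"
  shows "card (psubs Y N (Suc k)) \<le> card (psubs Y (adj z N) k) +
    2 ^ k * (card (psubs Y (adj z N) (Suc k)) + card (esubs Y (adj z N) (Suc k)))"
proof -
  let ?P = "psubs Y (adj z N) (Suc k)" and ?N = "adj z N"
  have le: "card {L \<in> chars K N. z \<notin> L} \<le> 2 ^ k + (if sq_in K ?N then 2 ^ k else 0)" if K: "K \<in> ?P" for K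
  proof (cases "sq_in K ?N")
    case True
    then show ?thesis using psubs_chars_le(1)[OF z fin K] by simp
  next
    case False
    then have "\<not> sq_in K N" using subset_adj[of N z] by (auto simp: sq_in_def)
    then show ?thesis using psubs_chars_le(2)[OF z fin K] by simp
  qed
  have "card (psubs Y N (Suc k)) = card (psubs Y ?N k) + (\<Sum>K\<in>?P. card {L \<in> chars K N. z \<notin> L})"
    by (rule card_psubs_Suc[OF z fin])
  also have "(\<Sum>K\<in>?P. card {L \<in> chars K N. z \<notin> L}) \<le> (\<Sum>K\<in>?P. 2 ^ k + (if sq_in K ?N then 2 ^ k else 0))"
    by (rule sum_mono) (rule le)
  also have "\<dots> = 2 ^ k * card ?P + (\<Sum>K\<in>?P. if sq_in K ?N then 2 ^ k else 0)"
    by (simp add: sum.distrib)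
  also have "(\<Sum>K\<in>?P. if sq_in K ?N then (2::nat) ^ k else 0) = (\<Sum>K\<in>esubs Y ?N (Suc k). 2 ^ k)"
    unfolding esubs_def by (rule sum.inter_filter[symmetric]) (rule finite_psubs[OF fin])
  finally show ?thesis by (simp add: algebra_simps)
qed

text \<open>The first term asks for squares in \<open>N\<close>, not merely in
  \<open>adj z N\<close>, so it may be smaller than the number of elementary abelian subgroups
  modulo \<open>adj z N\<close>.\<close>

lemma card_esubs_split:
  assumes z: "central_involution Y N z" and fin: "finite Y"
  shows "card (esubs Y N (Suc k)) = card {H \<in> psubs Y (adj z N) k. sq_in H N} +
    (\<Sum>K\<in>psubs Y (adj z N) (Suc k). card {L \<in> chars K N. z \<notin> L \<and> L \<in> esubs Y N (Suc k)})"
proof -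
  let ?E = "esubs Y N (Suc k)"
  have finE: "finite ?E" using finite_psubs[OF fin] by (simp add: esubs_def)
  have "?E = {H \<in> ?E. z \<in> H} \<union> {H \<in> ?E. z \<notin> H}" by blast
  then have "card ?E = card {H \<in> ?E. z \<in> H} + card {H \<in> ?E. z \<notin> H}"
    using finE card_Un_disjoint[of "{H \<in> ?E. z \<in> H}" "{H \<in> ?E. z \<notin> H}"]
    by (metis (no_types, lifting) disjoint_iff finite_Un mem_Collect_eq)
  also have "{H \<in> ?E. z \<in> H} = {H \<in> psubs Y (adj z N) k. sq_in H N}"
    using psubs_containing[OF z fin, of k] by (auto simp: esubs_def)
  also have "card {H \<in> ?E. z \<notin> H} = (\<Sum>K\<in>psubs Y (adj z N) (Suc k).
      card {L \<in> chars K N. z \<notin> L \<and> L \<in> {H \<in> ?E. z \<notin> H}})"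
    by (rule card_not_containing[OF z fin]) (auto simp: esubs_def)
  also have "\<dots> = (\<Sum>K\<in>psubs Y (adj z N) (Suc k). card {L \<in> chars K N. z \<notin> L \<and> L \<in> ?E})"
    by (intro sum.cong refl arg_cong[where f = card]) auto
  finally show ?thesis .
qed

lemma card_filtered_chars_sum_le:
  assumes z: "central_involution Y N z" and fin: "finite Y"
    and Q: "\<And>K L. K \<in> psubs Y (adj z N) k \<Longrightarrow> L \<in> chars K N \<Longrightarrow> z \<notin> L \<Longrightarrow> P L \<Longrightarrow> sq_in K N"
  shows "(\<Sum>K\<in>psubs Y (adj z N) k. card {L \<in> chars K N. z \<notin> L \<and> P L})
    \<le> 2 ^ k * card {K \<in> psubs Y (adj z N) k. sq_in K N}"
proof -
  let ?P = "psubs Y (adj z N) k"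
  have le: "card {L \<in> chars K N. z \<notin> L \<and> P L} \<le> (if sq_in K N then 2 ^ k else 0)" if K: "K \<in> ?P" for K
  proof (cases "sq_in K N")
    case True
    have "card {L \<in> chars K N. z \<notin> L \<and> P L} \<le> card {L \<in> chars K N. z \<notin> L}"
      using finite_chars finite_subset[OF psubsD(3)[OF K] fin] by (intro card_mono) auto
    then show ?thesis using True psubs_chars_le(1)[OF z fin K] by simp
  next
    case False
    then have "{L \<in> chars K N. z \<notin> L \<and> P L} = {}" using Q[OF K] by blast
    then show ?thesis by (simp only: card.empty)
  qed
  have "(\<Sum>K\<in>?P. card {L \<in> chars K N. z \<notin> L \<and> P L}) \<le> (\<Sum>K\<in>?P. if sq_in K N then 2 ^ k else 0)"
    by (rule sum_mono) (rule le)
  also have "\<dots> = (\<Sum>K\<in>{K \<in> ?P. sq_in K N}. 2 ^ k)"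
    by (rule sum.inter_filter[symmetric]) (rule finite_psubs[OF fin])
  finally show ?thesis by (simp add: mult.commute)
qed

text \<open>If the complement \<open>L\<close> is elementary abelian modulo \<open>N\<close>, so is
  \<open>K = adj z L\<close> by \<open>adj_sq_in\<close>; hence only such \<open>K\<close>
  contribute.\<close>

lemma card_esubs_Suc_le:
  assumes z: "central_involution Y N z" and fin: "finite Y"
  shows "card (esubs Y N (Suc k)) \<le>
    card (esubs Y (adj z N) k) + 2 ^ Suc k * card (esubs Y (adj z N) (Suc k))"
proof -
  have sub: "{K \<in> psubs Y (adj z N) i. sq_in K N} \<subseteq> esubs Y (adj z N) i" for i
    using subset_adj[of N z] by (auto simp: esubs_def sq_in_def)
  have fE: "finite (esubs Y (adj z N) i)" for i
    using finite_psubs[OF fin] by (simp add: esubs_def)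
  have "(\<Sum>K\<in>psubs Y (adj z N) (Suc k). card {L \<in> chars K N. z \<notin> L \<and> L \<in> esubs Y N (Suc k)})
      \<le> 2 ^ Suc k * card {K \<in> psubs Y (adj z N) (Suc k). sq_in K N}"
  proof (rule card_filtered_chars_sum_le[OF z fin])
    fix K L assume K: "K \<in> psubs Y (adj z N) (Suc k)" and L: "L \<in> chars K N" "z \<notin> L" "L \<in> esubs Y N (Suc k)"
    have "sq_in (adj z L) N"
      using adj_sq_in[OF z] L(3) psubsD unfolding esubs_def by blast
    then show "sq_in K N" using psubs_char(2)[OF z fin K L(1,2)] by simp
  qed
  also have "\<dots> \<le> 2 ^ Suc k * card (esubs Y (adj z N) (Suc k))"
    by (rule mult_le_mono2) (rule card_mono[OF fE sub])
  finally show ?thesis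
    using card_esubs_split[OF z fin, of k] card_mono[OF fE sub, of k] by linarith
qed

section \<open>Elementary abelian quotient by \<open>adj z N\<close>: the quadratic form of
  squaring\<close>

text \<open>A complement of \<open>z\<close> sees no square outside \<open>N\<close>: squares lie in every index-2 subgroup.\<close>

lemma chars_sq_in:
  assumes K: "subgroup K G" "sq_in K (adj z N)" and z: "z \<in> carrier G"
    and N: "subgroup N G" and L: "L \<in> chars K N" "z \<notin> L"
  shows "sq_in K N"
  unfolding sq_in_def
proof
  fix x assume x: "x \<in> K"
  note l = chars_subgroup[OF K(1) L(1)]
  show "x \<otimes> x \<in> N"
  proof (rule ccontr)
    assume "x \<otimes> x \<notin> N"
    then obtain n where n: "n \<in> N" "x \<otimes> x = z \<otimes> n"
      using K(2) x by (auto simp: sq_in_def adj_def)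
    have "z \<otimes> n \<in> L" using square_in_char[OF L(1) x] n by simp
    moreover have "inv n \<in> L" by (rule subgroup.m_inv_closed[OF l]) (use n charsD(1)[OF L(1)] in blast)
    ultimately have "z \<otimes> n \<otimes> inv n \<in> L" using subgroup.m_closed[OF l] by blast
    then show False using z n L(2) subgroup.mem_carrier[OF N] by (simp add: m_assoc)
  qed
qed

text \<open>By \<open>chars_sq_in\<close> only those \<open>K\<close> with squares in
  \<open>N\<close>, the totally singular subspaces, have complements of \<open>z\<close> at all.
  This reduces both counts to counting such \<open>K\<close>.\<close>

lemma index_two_bounds:
  assumes z: "central_involution Y N z" and fin: "finite Y" and sq: "sq_in Y (adj z N)"
    and card: "card Y = 2 ^ Suc n * card N"
  shows "card (psubs Y N (Suc k)) \<le> gbinom2 n k + 2 ^ Suc k * card {K \<in> psubs Y (adj z N) (Suc k). sq_in K N}"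
    and "card (esubs Y N (Suc k)) \<le> card {K \<in> psubs Y (adj z N) k. sq_in K N}
      + 2 ^ Suc k * card {K \<in> psubs Y (adj z N) (Suc k). sq_in K N}"
proof -
  note n = normal_inD[OF central_involutionD(1)[OF z]] and n' = normal_inD[OF adj_normal_in[OF z]]
  have zc: "z \<in> carrier G" using central_involutionD(2)[OF z] subgroup.subset[OF n(1)] by blast
  have *: "sq_in K N" if K: "K \<in> psubs Y (adj z N) i" and L: "L \<in> chars K N" "z \<notin> L" for K L i
    using chars_sq_in[OF psubsD(1)[OF K] _ zc n(2) L] sq psubsD(3)[OF K] by (auto simp: sq_in_def)
  have gb: "card (psubs Y (adj z N) k) = gbinom2 n k"
    by (rule card_psubs_sq_in[OF n(1) fin n'(2,3) sq]) (simp add: card card_adj_central[OF z fin])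
  show "card (psubs Y N (Suc k)) \<le> gbinom2 n k + 2 ^ Suc k * card {K \<in> psubs Y (adj z N) (Suc k). sq_in K N}"
    using card_psubs_Suc[OF z fin, of k] gb
      card_filtered_chars_sum_le[OF z fin, of "Suc k" "\<lambda>_. True"] * by simp
  show "card (esubs Y N (Suc k)) \<le> card {K \<in> psubs Y (adj z N) k. sq_in K N}
      + 2 ^ Suc k * card {K \<in> psubs Y (adj z N) (Suc k). sq_in K N}"
    using card_esubs_split[OF z fin, of k]
      card_filtered_chars_sum_le[OF z fin, of "Suc k" "\<lambda>L. L \<in> esubs Y N (Suc k)"] * by simp
qed

text \<open>Commutators lie in \<open>adj z N\<close>, and \<open>adj z N\<close> modulo
  \<open>N\<close> has order 2 and is central. So \<open>g \<mapsto> [g, x]\<close> is a sign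
  character modulo \<open>N\<close>; its kernel is the hyperplane orthogonal to \<open>x\<close> for
  the polar form, or everything.\<close>

lemma centralizer_char:
  assumes z: "central_involution Y N z" and fin: "finite Y" and sq: "sq_in Y (adj z N)" and x: "x \<in> Y"
  shows "{g \<in> Y. g \<otimes> x \<otimes> inv g \<otimes> inv x \<in> N} \<in> chars Y (adj x (adj z N))"
proof -
  let ?c = "\<lambda>g. g \<otimes> x \<otimes> inv g \<otimes> inv x" and ?N = "adj z N"
  let ?C = "{g \<in> Y. ?c g \<in> N}"
  note n = normal_inD[OF central_involutionD(1)[OF z]] and d = central_involutionD[OF z]
    and n' = normal_inD[OF adj_normal_in[OF z]]
  have c: "a \<in> carrier G" if "a \<in> Y" for a using subgroup.subset[OF n(1)] that by blast
  have cN: "?c g \<in> ?N" if "g \<in> Y" for g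
    by (rule sq_in_comm[OF n(1) n'(2) sq that x])
  \<comment> \<open>\<open>N\<close> has index 2 in \<open>adj z N\<close>, so membership in
    \<open>N\<close> is a parity for elements of \<open>adj z N\<close>.\<close>
  have NN: "N \<in> chars ?N N"
    by (rule charI[OF n(2) order_refl c[OF d(2)] d(3) n'(2)])
  have conj: "g \<otimes> a \<otimes> inv g \<in> N \<longleftrightarrow> a \<in> N" if "g \<in> Y" "a \<in> Y" for g a
  proof
    assume "g \<otimes> a \<otimes> inv g \<in> N"
    then have "inv g \<otimes> (g \<otimes> a \<otimes> inv g) \<otimes> inv (inv g) \<in> N"
      by (rule n(4)[OF subgroup.m_inv_closed[OF n(1) that(1)]])
    then show "a \<in> N" using c[OF that(1)] c[OF that(2)] by (simp add: m_assoc inv_mult_cancel)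
  qed (rule n(4)[OF that(1)])
  have "?c (g \<otimes> h) \<in> N \<longleftrightarrow> (?c g \<in> N \<longleftrightarrow> ?c h \<in> N)" if gh: "g \<in> Y" "h \<in> Y" for g h
  proof -
    have "?c (g \<otimes> h) = (g \<otimes> ?c h \<otimes> inv g) \<otimes> ?c g"
      using c gh x by (simp add: m_assoc inv_mult_cancel inv_mult_group)
    moreover have "g \<otimes> ?c h \<otimes> inv g \<in> ?N" by (rule n'(4)[OF gh(1) cN[OF gh(2)]])
    ultimately have "?c (g \<otimes> h) \<in> N \<longleftrightarrow> (g \<otimes> ?c h \<otimes> inv g \<in> N \<longleftrightarrow> ?c g \<in> N)"
      using charsD(3)[OF NN _ cN[OF gh(1)]] by simp
    then show ?thesis using conj[OF gh(1)] cN[OF gh(2)] n'(3) by blast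
  qed
  \<comment> \<open>Triviality on the empty set suffices to make \<open>?C\<close> a subgroup; then
    \<open>adj x ?N \<subseteq> ?C\<close> only has to be checked on \<open>N\<close>,
    \<open>z\<close> and \<open>x\<close>.\<close>
  then have C: "?C \<in> chars Y {}"
    using subgroup.m_closed[OF n(1)] by (auto simp: chars_def)
  have sC: "subgroup ?C G" by (rule chars_subgroup[OF n(1) C])
  have "N \<subseteq> ?C"
  proof
    fix a assume a: "a \<in> N"
    have ac: "a \<in> Y" using a n(3) by blast
    have "x \<otimes> inv a \<otimes> inv x \<in> N"
      by (rule n(4)[OF x subgroup.m_inv_closed[OF n(2) a]])
    then have "a \<otimes> (x \<otimes> inv a \<otimes> inv x) \<in> N" by (rule subgroup.m_closed[OF n(2) a])
    then show "a \<in> ?C" using ac c[OF ac] c[OF x] by (simp add: m_assoc)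
  qed
  moreover have "z \<in> ?C"
  proof -
    have "inv (x \<otimes> z \<otimes> inv x \<otimes> inv z) \<in> N"
      by (rule subgroup.m_inv_closed[OF n(2) d(5)[OF x]])
    then show ?thesis using d(2) c[OF d(2)] c[OF x] by (simp add: m_assoc inv_mult_group)
  qed
  moreover have "x \<in> ?C" using x c[OF x] subgroup.one_closed[OF n(2)] by (simp add: m_assoc)
  ultimately have "adj x ?N \<subseteq> ?C" using adj_subset[OF sC] by simp
  then show ?thesis using C by (auto simp: chars_def)
qed

text \<open>If \<open>u\<close> lies in just one of \<open>K\<close> and \<open>L\<close> and
  commutes with \<open>x\<close> modulo \<open>N\<close>, then \<open>u \<otimes> x\<close> lies in
  the other one, so the squares of \<open>u\<close> and of \<open>u \<otimes> x\<close> are in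
  \<open>N\<close>, and with them that of \<open>x\<close>, a contradiction. Hence \<open>K\<close>
  and \<open>L\<close> agree on \<open>U \<inter> C\<close>, and \<open>L\<close> is
  \<open>K\<close> multiplied by the character with kernel \<open>C\<close>.\<close>

lemma toggled_char_unique:
  assumes N: "normal_in Y N" and U: "subgroup U G" "finite U" "U \<subseteq> Y"
    and C: "C = {g \<in> Y. g \<otimes> x \<otimes> inv g \<otimes> inv x \<in> N}" "C \<in> chars Y M" and x: "x \<in> U" "x \<otimes> x \<notin> N"
    and K: "K \<in> chars U N'" "sq_in K N" and L: "L \<in> chars U N'" "sq_in L N" and ne: "K \<noteq> L"
  shows "\<not> U \<subseteq> C" "L = {u \<in> U. u \<in> K \<longleftrightarrow> u \<in> C}"
proof -
  note n = normal_inD[OF N]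
  have c: "a \<in> carrier G" if "a \<in> Y" for a using subgroup.subset[OF n(1)] that by blast
  have xY: "x \<in> Y" using x U by blast
  have notC: "u \<notin> C" if A: "A \<in> chars U N'" "sq_in A N" and B: "B \<in> chars U N'" "sq_in B N"
    and u: "u \<in> A" "u \<notin> B" for A B u
  proof
    assume "u \<in> C"
    then have uN: "u \<otimes> x \<otimes> inv u \<otimes> inv x \<in> N" (is "?n \<in> N") and uY: "u \<in> Y" using C by auto
    have "x \<notin> B" using B(2) x(2) by (auto simp: sq_in_def)
    then have "u \<otimes> x \<in> B" using charsD(3)[OF B(1)] charsD(2)[OF A(1)] u x(1) by blast
    then have "(u \<otimes> x) \<otimes> (u \<otimes> x) \<in> N" using B(2) by (simp add: sq_in_def)
    moreover have "u \<otimes> u \<in> N" using A(2) u(1) by (simp add: sq_in_def)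
    then have "x \<otimes> (u \<otimes> u) \<otimes> inv x \<in> N" by (rule n(4)[OF xY])
    then have "inv (?n \<otimes> (x \<otimes> (u \<otimes> u) \<otimes> inv x)) \<in> N"
      using uN subgroup.m_closed[OF n(2)] subgroup.m_inv_closed[OF n(2)] by blast
    ultimately have "inv (?n \<otimes> (x \<otimes> (u \<otimes> u) \<otimes> inv x)) \<otimes> ((u \<otimes> x) \<otimes> (u \<otimes> x)) \<in> N"
      using subgroup.m_closed[OF n(2)] by blast
    moreover have "inv (?n \<otimes> (x \<otimes> (u \<otimes> u) \<otimes> inv x)) \<otimes> ((u \<otimes> x) \<otimes> (u \<otimes> x)) = x \<otimes> x"
      using c[OF xY] c[OF uY] by (simp add: m_assoc inv_mult_cancel inv_mult_group)
    ultimately show False using x(2) by simp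
  qed
  let ?T = "{u \<in> U. u \<in> K \<longleftrightarrow> u \<in> L}"
  have sub: "U \<inter> C \<subseteq> ?T" using notC[OF K L] notC[OF L K] by blast
  have T: "?T \<in> chars U {}"
    using chars_toggle[OF U(1) _ _ , of "{}" K L] K(1) L(1) by (auto simp: chars_def)
  have UC: "U \<inter> C \<in> chars U {}"
    using charsD(3)[OF C(2)] U(3) subgroup.m_closed[OF U(1)] by (auto simp: chars_def subset_iff)
  have TU: "?T \<noteq> U" using ne charsD(2)[OF K(1)] charsD(2)[OF L(1)] by blast
  then show nUC: "\<not> U \<subseteq> C" using sub by blast
  \<comment> \<open>Both sets are proper character kernels in \<open>U\<close>, so they have the
    same order and the inclusion is an equality.\<close>
  have "card ?T = card (U \<inter> C)"
    using card_char[OF U(1,2) T TU] card_char[OF U(1,2) UC] nUC by force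
  then have "U \<inter> C = ?T" using card_subset_eq[OF _ sub] U(2) by simp
  then show "L = {u \<in> U. u \<in> K \<longleftrightarrow> u \<in> C}" using charsD(2)[OF L(1)] by blast
qed

text \<open>No counted \<open>K\<close> contains \<open>x\<close>, so
  \<open>card_not_containing\<close> applies with \<open>x\<close> in the role of \<open>z\<close>
  and sorts them by \<open>U = adj x K\<close>. The fibres have at most one element if
  \<open>U \<subseteq> C\<close> and at most two otherwise; \<open>hyp2_gbinom2\<close> turns the
  resulting sum into \<open>hyp2\<close>.\<close>

lemma card_elementary_over_le:
  assumes z: "central_involution Y N z" and fin: "finite Y" and sq: "sq_in Y (adj z N)"
    and nsq: "\<not> sq_in Y N" and card: "card Y = 2 ^ Suc (Suc (Suc m)) * card N"
  shows "card {K \<in> psubs Y (adj z N) k. sq_in K N} \<le> hyp2 m k"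
proof -
  let ?N = "adj z N"
  let ?F = "{K \<in> psubs Y ?N k. sq_in K N}"
  note n = normal_inD[OF central_involutionD(1)[OF z]] and d = central_involutionD[OF z]
    and n' = normal_inD[OF adj_normal_in[OF z]]
  obtain x where x: "x \<in> Y" "x \<otimes> x \<notin> N" using nsq by (auto simp: sq_in_def)
  have out: "x \<notin> H" if "sq_in H N" for H using that x(2) by (auto simp: sq_in_def)
  have "sq_in N N" using subgroup.m_closed[OF n(2)] by (auto simp: sq_in_def)
  then have xN: "x \<notin> ?N" using out adj_sq_in[OF z n(2,3)] by blast
  have cx: "central_involution Y ?N x"
    by (rule sq_in_central_involution[OF n(1) n'(2,3) sq x(1) xN])
  let ?M = "adj x ?N"
  define C where "C = {g \<in> Y. g \<otimes> x \<otimes> inv g \<otimes> inv x \<in> N}"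
  have C: "C \<in> chars Y ?M" unfolding C_def by (rule centralizer_char[OF z fin sq x(1)])
  note m' = normal_inD[OF adj_normal_in[OF cx]]
  have sqM: "sq_in Y ?M" using sq subset_adj[of ?N x] by (auto simp: sq_in_def)
  have cM: "card ?M = 4 * card N" using card_adj_central[OF z fin] card_adj_central[OF cx fin] by simp
  have all: "card (psubs Y ?M k) = gbinom2 (Suc m) k"
    by (rule card_psubs_sq_in[OF n(1) fin m'(2,3) sqM]) (simp add: card cM)
  have sC: "subgroup C G" by (rule chars_subgroup[OF n(1) C])
  have CY: "C \<subseteq> Y" by (rule charsD(2)[OF C])
  \<comment> \<open>\<open>C\<close> is \<open>Y\<close> when \<open>x\<close> is central modulo
    \<open>N\<close>; then even more subspaces lie in \<open>C\<close>.\<close>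
  have inC: "gbinom2 m k \<le> card (psubs C ?M k)"
  proof (cases "C = Y")
    case True
    then show ?thesis using all gbinom2_mono by simp
  next
    case False
    have "card C = 2 ^ m * card ?M" using card_char[OF n(1) fin C False] card cM by (simp add: algebra_simps)
    moreover have "sq_in C ?M" using sqM CY by (auto simp: sq_in_def)
    ultimately have "card (psubs C ?M k) = gbinom2 m k"
      using card_psubs_sq_in[OF sC finite_subset[OF CY fin] m'(2) charsD(1)[OF C]] by blast
    then show ?thesis by simp
  qed
  have psC: "{U \<in> psubs Y ?M k. U \<subseteq> C} = psubs C ?M k"
    using CY by (auto simp: psubs_def)
  \<comment> \<open>The extra unit for \<open>U \<subseteq> C\<close> merges the bounds 1 and 2 into
    a uniform bound 2.\<close>
  have fibre: "card {K \<in> chars U ?N. x \<notin> K \<and> K \<in> ?F} + (if U \<subseteq> C then 1 else 0) \<le> 2"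
    if U: "U \<in> psubs Y ?M k" for U
  proof -
    note u = psubsD[OF U]
    have fU: "finite U" by (rule finite_subset[OF u(3) fin])
    let ?S = "{K \<in> chars U ?N. x \<notin> K \<and> K \<in> ?F}"
    note uniq = toggled_char_unique[OF d(1) u(1) fU u(3) C_def C central_involution_mem(1)[OF cx U] x(2)]
    show ?thesis
    proof (cases "?S = {}")
      case False
      then obtain K where K: "K \<in> ?S" by blast
      have "?S \<subseteq> (if U \<subseteq> C then {K} else {K, {u \<in> U. u \<in> K \<longleftrightarrow> u \<in> C}})"
        using uniq[of K ?N] K by auto
      then have "card ?S \<le> card (if U \<subseteq> C then {K} else {K, {u \<in> U. u \<in> K \<longleftrightarrow> u \<in> C}})"
        by (rule card_mono[rotated]) simp
      also have "\<dots> \<le> (if U \<subseteq> C then 1 else 2)" by (simp add: card_insert_if)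
      finally show ?thesis by (auto split: if_splits)
    qed (simp only: card.empty, simp)
  qed
  have "card ?F = (\<Sum>U\<in>psubs Y ?M k. card {K \<in> chars U ?N. x \<notin> K \<and> K \<in> ?F})"
    by (rule card_not_containing[OF cx fin]) (use out in auto)
  moreover have "card (psubs C ?M k) = (\<Sum>U\<in>psubs Y ?M k. if U \<subseteq> C then 1 else 0)"
    using psC sum.inter_filter[OF finite_psubs[OF fin, of ?M k], of "\<lambda>_. 1::nat" "\<lambda>U. U \<subseteq> C"] by simp
  ultimately have "card ?F + card (psubs C ?M k) =
      (\<Sum>U\<in>psubs Y ?M k. card {K \<in> chars U ?N. x \<notin> K \<and> K \<in> ?F} + (if U \<subseteq> C then 1 else 0))"
    by (simp only: sum.distrib)
  also have "\<dots> \<le> (\<Sum>U\<in>psubs Y ?M k. 2)" by (rule sum_mono) (rule fibre)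
  also have "\<dots> = 2 * gbinom2 (Suc m) k" by (simp add: all)
  finally show ?thesis using inC hyp2_gbinom2[of m k] by linarith
qed

end

section \<open>Existence of central involutions\<close>

lemma even_card_moved_by_involution:
  assumes "finite A" "\<And>x. x \<in> A \<Longrightarrow> f x \<in> A" "\<And>x. x \<in> A \<Longrightarrow> f (f x) = x"
  shows "even (card {x \<in> A. f x \<noteq> x})"
proof -
  let ?B = "{x \<in> A. f x \<noteq> x}"
  let ?C = "(\<lambda>x. {x, f x}) ` ?B"
  have U: "\<Union> ?C = ?B" using assms(2,3) by fastforce
  have "2 dvd card (\<Union> ?C)"
  proof (rule dvd_partition)
    show "finite (\<Union> ?C)" unfolding U using assms(1) by simp
    show "\<forall>c\<in>?C. 2 dvd card c" by (auto simp: card_insert_if)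
    have "{x, f x} = {y, f y}" if "x \<in> ?B" "y \<in> ?B" "a \<in> {x, f x}" "a \<in> {y, f y}" for x y a
    proof -
      have inv: "f (f x) = x" "f (f y) = y" using that assms(3) by simp_all
      have "a = x \<or> a = f x" "a = y \<or> a = f y" using that(3,4) by simp_all
      then have "y = x \<or> y = f x" using inv by metis
      then show ?thesis
      proof
        assume "y = f x"
        then show ?thesis using inv(1) by (simp only: insert_commute)
      qed simp
    qed
    then show "\<forall>c1\<in>?C. \<forall>c2\<in>?C. c1 \<noteq> c2 \<longrightarrow> c1 \<inter> c2 = {}" by blast
  qed
  then show ?thesis unfolding U .
qed

context group
begin

text \<open>Without such \<open>z\<close>, every conjugacy class of elements of order 2 has even
  size, being a power of 2 other than 1, so there is an even number of these elements. But inversion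
  pairs off all elements outside \<open>?W\<close>, so \<open>?W\<close>, which also contains the
  identity, has even order: a contradiction.\<close>

lemma ex_central_order_two:
  assumes fin: "finite (carrier G)" and card: "order G = 2 ^ Suc n"
  shows "\<exists>z\<in>carrier G. z \<noteq> \<one> \<and> z \<otimes> z = \<one> \<and> (\<forall>g\<in>carrier G. g \<otimes> z = z \<otimes> g)"
proof (rule ccontr)
  assume none: "\<not> ?thesis"
  define \<phi> where "\<phi> = (\<lambda>g. \<lambda>h\<in>carrier G. g \<otimes> h \<otimes> inv g)"
  interpret group_action G "carrier G" \<phi>
    unfolding \<phi>_def by (rule action_by_conjugation)
  let ?W = "{x \<in> carrier G. x \<otimes> x = \<one>}"
  let ?C = "orbit G \<phi> ` (?W - {\<one>})"
  have orb: "orbit G \<phi> x = (\<lambda>g. g \<otimes> x \<otimes> inv g) ` carrier G" if "x \<in> carrier G" for x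
    using that by (auto simp: orbit_def \<phi>_def)
  have inW: "orbit G \<phi> x \<subseteq> ?W - {\<one>}" if x: "x \<in> ?W - {\<one>}" for x
  proof
    fix y assume "y \<in> orbit G \<phi> x"
    then obtain g where g: "g \<in> carrier G" "y = g \<otimes> x \<otimes> inv g" using orb x by auto
    have xc: "x \<in> carrier G" using x by blast
    have "y \<otimes> y = g \<otimes> (x \<otimes> x) \<otimes> inv g" using g xc by (simp add: m_assoc inv_mult_cancel)
    then have "y \<otimes> y = \<one>" using g x by simp
    moreover have "x = inv g \<otimes> y \<otimes> g" using g xc by (simp add: m_assoc inv_mult_cancel)
    then have "y \<noteq> \<one>" using g x by auto
    ultimately show "y \<in> ?W - {\<one>}" using g x by auto
  qed
  have U: "\<Union> ?C = ?W - {\<one>}"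
    using inW orbit_refl by blast
  have "2 dvd card (\<Union> ?C)"
  proof (rule dvd_partition)
    show "finite (\<Union> ?C)" unfolding U using fin by simp
    show "\<forall>c\<in>?C. 2 dvd card c"
    proof
      fix c assume "c \<in> ?C"
      then obtain x where x: "x \<in> ?W - {\<one>}" and c: "c = orbit G \<phi> x" by blast
      have "card c dvd 2 ^ Suc n"
        using orbit_stabilizer_theorem[of x] x card unfolding c by (metis DiffD1 dvd_triv_left mem_Collect_eq)
      then obtain i where i: "card c = 2 ^ i" using divides_primepow_nat two_is_prime_nat by blast
      have "i \<noteq> 0"
      proof
        assume "i = 0"
        then obtain a where "c = {a}" using i card_1_singletonE by (metis power_0)
        then have ca: "c = {x}" using orbit_refl[of x] x unfolding c by auto
        have "g \<otimes> x = x \<otimes> g" if g: "g \<in> carrier G" for g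
        proof -
          have "g \<otimes> x \<otimes> inv g = x" using ca orb[of x] x g unfolding c by blast
          then have "g \<otimes> x \<otimes> inv g \<otimes> g = x \<otimes> g" by simp
          then show ?thesis using g x by (simp add: m_assoc)
        qed
        then show False using none x by blast
      qed
      then show "2 dvd card c" using i by simp
    qed
    show "\<forall>c1\<in>?C. \<forall>c2\<in>?C. c1 \<noteq> c2 \<longrightarrow> c1 \<inter> c2 = {}"
      using disjoint_union by (fastforce simp: orbits_def)
  qed
  then have "odd (Suc (card (?W - {\<one>})))" unfolding U even_Suc not_not .
  moreover have "even (card ?W)"
  proof -
    have "even (card {x \<in> carrier G. inv x \<noteq> x})"
      by (rule even_card_moved_by_involution) (use fin in auto)
    moreover have "even (card (carrier G))" using card by (simp add: order_def)
    moreover have "?W = carrier G - {x \<in> carrier G. inv x \<noteq> x}"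
      using inv_equality r_inv by fastforce
    ultimately show ?thesis using fin by (simp add: card_Diff_subset)
  qed
  moreover have "Suc (card (?W - {\<one>})) = card ?W"
    by (rule card_Suc_Diff1) (use fin in auto)
  ultimately show False by (simp only: not_True_eq_False)
qed

text \<open>The only place where a factor group is formed: a central involution of
  \<open>G Mod N\<close> is lifted to a coset representative.\<close>

lemma ex_central_involution:
  assumes N: "normal_in (carrier G) N" and fin: "finite (carrier G)"
    and card: "card (carrier G) = 2 ^ Suc n * card N"
  shows "\<exists>z. central_involution (carrier G) N z"
proof -
  note n = normal_inD[OF N]
  have "N \<lhd> G" using n by (simp add: normal_inv_iff)
  then interpret normal N G .
  interpret Q: group "G Mod N" by (rule factorgroup_is_group)
  have pos: "0 < card N"
    using finite_subset[OF n(3) fin] subgroup.one_closed[OF n(2)] card_gt_0_iff by blast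
  have "card (rcosets N) * card N = order G" by (rule lagrange[OF n(2)])
  then have ord: "order (G Mod N) = 2 ^ Suc n"
    using card pos by (simp add: order_def FactGroup_def)
  have "finite (carrier (G Mod N))"
    unfolding carrier_FactGroup using fin by simp
  from Q.ex_central_order_two[OF this ord]
  obtain w where w: "w \<in> carrier (G Mod N)" "w \<noteq> \<one>\<^bsub>G Mod N\<^esub>"
      "w \<otimes>\<^bsub>G Mod N\<^esub> w = \<one>\<^bsub>G Mod N\<^esub>"
      "\<forall>g\<in>carrier (G Mod N). g \<otimes>\<^bsub>G Mod N\<^esub> w = w \<otimes>\<^bsub>G Mod N\<^esub> g"
    by (elim bexE conjE) (rule that)
  from w(1) obtain z where z: "z \<in> carrier G" "w = N #> z" unfolding carrier_FactGroup by (rule imageE) (rule that)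
  have "z \<notin> N" using w(2) z coset_join2[OF z(1) n(2)] by auto
  moreover have "z \<otimes> z \<in> N"
  proof -
    have "N #> (z \<otimes> z) = N" using w(3) z by (simp add: rcos_sum)
    then show ?thesis using coset_join1 z(1) n(2) by blast
  qed
  moreover have "g \<otimes> z \<otimes> inv g \<otimes> inv z \<in> N" if g: "g \<in> carrier G" for g
  proof -
    have "N #> g \<in> carrier (G Mod N)" using g by (simp add: carrier_FactGroup)
    then have "N #> (g \<otimes> z) = N #> (z \<otimes> g)" using bspec[OF w(4), of "N #> g"] z g by (simp add: rcos_sum)
    moreover have "g \<otimes> z \<in> N #> (g \<otimes> z)" by (rule rcos_self[OF _ n(2)]) (use g z in simp)
    ultimately have "(g \<otimes> z) \<otimes> inv (z \<otimes> g) \<in> N"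
      using rcos_module[OF is_group, of "z \<otimes> g" "g \<otimes> z"] g z by simp
    then show ?thesis using g z by (simp add: inv_mult_group m_assoc)
  qed
  ultimately show ?thesis using N z by (auto simp: central_involution_def)
qed

section \<open>Small quotients and the induction for the upper bounds\<close>

lemma psubs_index_two_top:
  assumes fin: "finite Y" and card: "card Y = 2 * card N" and K: "K \<in> psubs Y N (Suc k)"
  shows "K = Y"
proof -
  have "1 * card Y \<le> 2 ^ k * card Y" by (rule mult_le_mono1) simp
  then have "card Y \<le> card K" using psubsD(4)[OF K] card by simp
  then show ?thesis using card_seteq[OF fin psubsD(3)[OF K]] by blast
qed

text \<open>The quotient is cyclic of order 4: one subgroup of each order, of which only the whole
  quotient is not elementary abelian.\<close>

lemma index_four_bounds:
  assumes N: "normal_in (carrier G) N" and fin: "finite (carrier G)"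
    and card: "card (carrier G) = 4 * card N" and nsq: "\<not> sq_in (carrier G) N"
  shows "card (psubs (carrier G) N k) \<le> (if k \<le> 2 then 1 else 0)"
    and "card (esubs (carrier G) N k) \<le> (if k \<le> 1 then 1 else 0)"
proof -
  let ?Y = "carrier G"
  obtain z where z: "central_involution ?Y N z"
    using ex_central_involution[OF N fin, of 1] card by auto
  note n' = normal_inD[OF adj_normal_in[OF z]]
  let ?N = "adj z N"
  have c': "card ?Y = 2 * card ?N" using card card_adj_central[OF z fin] by simp
  have sq: "sq_in ?Y ?N"
  proof (cases "?N = ?Y")
    case True
    then show ?thesis by (auto simp: sq_in_def)
  next
    case False
    then obtain y where y: "y \<in> ?Y" "y \<notin> ?N" using n'(3) by blast
    have "adj y ?N = ?Y"
      using card_subset_eq[OF fin adj_subset[OF n'(1) n'(3) y(1)]]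
        card_adj[OF n'(2) finite_subset[OF n'(3) fin] y] c' by simp
    then have "?N \<in> chars ?Y ?N"
      using charI[OF n'(2) order_refl y] n'(1) by simp
    then show ?thesis using square_in_char by (auto simp: sq_in_def)
  qed
  \<comment> \<open>Above exponent 0 only the whole group can occur, and its squares are not all in
    \<open>N\<close>.\<close>
  have top: "{K \<in> psubs ?Y ?N (Suc i). sq_in K N} = {}" for i
    using psubs_index_two_top[OF fin c'] nsq by blast
  have bot: "card {K \<in> psubs ?Y ?N 0. sq_in K N} \<le> 1"
    using psubs_0[OF n'(2,3) fin] card_mono[of "{?N}" "{K \<in> {?N}. sq_in K N}"] by auto
  have c1: "card ?Y = 2 ^ Suc 1 * card N" using card by simp
  note b = index_two_bounds[OF z fin sq c1]
  have z0: "psubs ?Y N 0 = {N}" by (rule psubs_0[OF normal_inD(2,3)[OF N] fin])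
  show "card (psubs ?Y N k) \<le> (if k \<le> 2 then 1 else 0)"
  proof (cases k)
    case (Suc j)
    have "card (psubs ?Y N (Suc j)) \<le> gbinom2 1 j" using b(1)[of j] top by simp
    also have "gbinom2 1 j \<le> (if k \<le> 2 then 1 else 0)"
    proof (cases j)
      case (Suc i)
      then show ?thesis using \<open>k = Suc j\<close> by (cases i) auto
    qed (use Suc in simp)
    finally show ?thesis using Suc by simp
  qed (simp add: z0)
  show "card (esubs ?Y N k) \<le> (if k \<le> 1 then 1 else 0)"
  proof (cases k)
    case 0
    have "esubs ?Y N 0 \<subseteq> {N}" using z0 by (auto simp: esubs_def)
    from card_mono[OF _ this] show ?thesis using 0 by simp
  next
    case (Suc j)
    have "card (esubs ?Y N (Suc j)) \<le> card {K \<in> psubs ?Y ?N j. sq_in K N}" using b(2)[of j] top by simp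
    also have "\<dots> \<le> (if k \<le> 1 then 1 else 0)"
    proof (cases j)
      case 0
      then show ?thesis using bot Suc by simp
    next
      case (Suc i)
      show ?thesis unfolding Suc top card.empty by simp
    qed
    finally show ?thesis using Suc by simp
  qed
qed

lemma psubs_0_bounds:
  assumes N: "normal_in Y N" and fin: "finite Y"
  shows "card (psubs Y N 0) \<le> 1" "card (esubs Y N 0) \<le> 1"
proof -
  have z0: "psubs Y N 0 = {N}" by (rule psubs_0[OF normal_inD(2,3)[OF N] fin])
  then show "card (psubs Y N 0) \<le> 1" by simp
  have "esubs Y N 0 \<subseteq> {N}" using z0 by (auto simp: esubs_def)
  from card_mono[OF _ this] show "card (esubs Y N 0) \<le> 1" by simp
qed

lemma elementary_quotient_bounds:
  assumes z: "central_involution Y N z" and fin: "finite Y" and sq: "sq_in Y (adj z N)"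
    and nsq: "\<not> sq_in Y N" and card: "card Y = 2 ^ Suc (Suc (Suc m)) * card N"
  shows "card (psubs Y N k) \<le> sub_bound m k" "card (esubs Y N k) \<le> elem_bound m k"
proof -
  let ?T = "\<lambda>k. card {K \<in> psubs Y (adj z N) k. sq_in K N}"
  have T: "?T i \<le> hyp2 m i" for i
    by (rule card_elementary_over_le[OF assms])
  then have T2: "2 ^ i * ?T i \<le> 2 ^ i * hyp2 m i" for i by simp
  note b = index_two_bounds[OF z fin sq card]
  note b0 = psubs_0_bounds[OF central_involutionD(1)[OF z] fin]
  show "card (psubs Y N k) \<le> sub_bound m k"
  proof (cases k)
    case (Suc j)
    show ?thesis unfolding Suc sub_bound.simps using b(1)[of j] T2[of "Suc j"] by linarith
  qed (use b0 in simp)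
  show "card (esubs Y N k) \<le> elem_bound m k"
  proof (cases k)
    case (Suc j)
    show ?thesis unfolding Suc elem_bound.simps using b(2)[of j] T2[of "Suc j"] T[of j] by linarith
  qed (use b0 in simp)
qed

text \<open>Both bounds are proved together because the recursion for all subgroups involves the
  elementary abelian ones. If the quotient by \<open>adj z N\<close> is elementary abelian, the
  quadratic form argument applies directly; otherwise the induction hypothesis is used for
  \<open>adj z N\<close>.\<close>

lemma nonelementary_bounds:
  assumes "finite (carrier G)" "normal_in (carrier G) N"
    and "card (carrier G) = 2 ^ Suc (Suc (Suc m)) * card N" and "\<not> sq_in (carrier G) N"
  shows "card (psubs (carrier G) N k) \<le> sub_bound m k \<and> card (esubs (carrier G) N k) \<le> elem_bound m k"
  using assms(2-)
proof (induction m arbitrary: N k)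
  case 0
  let ?Y = "carrier G"
  obtain z where z: "central_involution ?Y N z"
    using ex_central_involution[OF 0(1) assms(1), of 2] 0(2) by (auto simp: eval_nat_numeral)
  show ?case
  proof (cases "sq_in ?Y (adj z N)")
    case True
    then show ?thesis using elementary_quotient_bounds[OF z assms(1) True 0(3,2)] by blast
  next
    case False
    \<comment> \<open>The smallest instance of \<open>sub_bound\<close> belongs to order 8, so this
      quotient of order 4 is treated separately and the bounds are compared by cases on
      \<open>j\<close>.\<close>
    have "card ?Y = 4 * card (adj z N)" using 0(2) card_adj_central[OF z assms(1)] by simp
    note b = index_four_bounds[OF adj_normal_in[OF z] assms(1) this False]
    note b0 = psubs_0_bounds[OF 0(1) assms(1)]
    show ?thesis
    proof (cases k)
      case (Suc j)
      have "card (psubs ?Y N (Suc j)) \<le> (if j \<le> 2 then 1 else 0) +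
          2 ^ j * ((if Suc j \<le> 2 then 1 else 0) + (if Suc j \<le> 1 then 1 else 0))"
        by (rule order_trans[OF card_psubs_Suc_le[OF z assms(1)]])
          (intro add_mono mult_le_mono2 b)
      also have "\<dots> \<le> sub_bound 0 (Suc j)"
      proof -
        consider "j = 0" | "j = 1" | "j = 2" | "2 < j" by linarith
        then show ?thesis by cases (simp_all add: eval_nat_numeral)
      qed
      finally have 1: "card (psubs ?Y N (Suc j)) \<le> sub_bound 0 (Suc j)" .
      have "card (esubs ?Y N (Suc j)) \<le> (if j \<le> 1 then 1 else 0) +
          2 ^ Suc j * (if Suc j \<le> 1 then 1 else 0)"
        by (rule order_trans[OF card_esubs_Suc_le[OF z assms(1)]])
          (intro add_mono mult_le_mono2 b)
      also have "\<dots> \<le> elem_bound 0 (Suc j)"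
      proof -
        consider "j = 0" | "j = 1" | "1 < j" by linarith
        then show ?thesis by cases (simp_all add: eval_nat_numeral)
      qed
      finally show ?thesis using 1 Suc by simp
    qed (use b0 in simp)
  qed
next
  case (Suc m)
  let ?Y = "carrier G"
  obtain z where z: "central_involution ?Y N z"
    using ex_central_involution[OF Suc.prems(1) assms(1) Suc.prems(2)] by blast
  show ?case
  proof (cases "sq_in ?Y (adj z N)")
    case True
    then show ?thesis using elementary_quotient_bounds[OF z assms(1) True Suc.prems(3,2)] by blast
  next
    case False
    have "card ?Y = 2 ^ Suc (Suc (Suc m)) * card (adj z N)"
      using Suc.prems(2) card_adj_central[OF z assms(1)] by simp
    from Suc.IH[OF adj_normal_in[OF z] this False]
    have b: "card (psubs ?Y (adj z N) i) \<le> sub_bound m i" "card (esubs ?Y (adj z N) i) \<le> elem_bound m i" for i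
      by auto
    note b0 = psubs_0_bounds[OF Suc.prems(1) assms(1)]
    show ?thesis
    proof (cases k)
      case (Suc j)
      have "card (psubs ?Y N (Suc j)) \<le> sub_bound m j + 2 ^ j * (sub_bound m (Suc j) + elem_bound m (Suc j))"
        by (rule order_trans[OF card_psubs_Suc_le[OF z assms(1)]])
          (intro add_mono mult_le_mono2 b)
      moreover have "card (esubs ?Y N (Suc j)) \<le> elem_bound m j + 2 ^ Suc j * elem_bound m (Suc j)"
        by (rule order_trans[OF card_esubs_Suc_le[OF z assms(1)]])
          (intro add_mono mult_le_mono2 b)
      ultimately show ?thesis unfolding Suc sub_bound_Suc elem_bound_Suc by blast
    qed (use b0 in simp)
  qed
qed

section \<open>Lower bound and passage to the trivial subgroup\<close>

text \<open>Each \<open>K\<close> in \<open>F\<close> is elementary abelian modulo \<open>N\<close>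
  and so has exactly \<open>2 ^ Suc k\<close> complements of \<open>z\<close>. \<open>F\<close> need
  not contain all such \<open>K\<close>.\<close>

lemma elementary_quotient_lower_bound:
  assumes z: "central_involution Y N z" and fin: "finite Y" and sq: "sq_in Y (adj z N)"
    and card: "card Y = 2 ^ Suc n * card N"
    and F: "F \<subseteq> psubs Y (adj z N) (Suc k)" "\<And>K. K \<in> F \<Longrightarrow> sq_in K N"
  shows "gbinom2 n k + 2 ^ Suc k * card F \<le> card (psubs Y N (Suc k))"
proof -
  note n = normal_inD[OF central_involutionD(1)[OF z]] and n' = normal_inD[OF adj_normal_in[OF z]]
  have gb: "card (psubs Y (adj z N) k) = gbinom2 n k"
    by (rule card_psubs_sq_in[OF n(1) fin n'(2,3) sq]) (simp add: card card_adj_central[OF z fin])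
  have "card {L \<in> chars K N. z \<notin> L} = 2 ^ Suc k" if K: "K \<in> F" for K
  proof -
    have K': "K \<in> psubs Y (adj z N) (Suc k)" using F(1) K by blast
    note p = psubsD[OF K'] and q = central_involution_mem[OF z K']
    show ?thesis
      by (rule card_chars_not_mem_eq[OF p(1) finite_subset[OF p(3) fin] n(2) q(2) _ q(1)
          central_involutionD(3)[OF z] F(2)[OF K]])
        (simp add: p(4) card_adj_central[OF z fin])
  qed
  then have "(\<Sum>K\<in>F. card {L \<in> chars K N. z \<notin> L}) = 2 ^ Suc k * card F" by simp
  moreover have "(\<Sum>K\<in>F. card {L \<in> chars K N. z \<notin> L})
      \<le> (\<Sum>K\<in>psubs Y (adj z N) (Suc k). card {L \<in> chars K N. z \<notin> L})"
    by (rule sum_mono2[OF finite_psubs[OF fin] F(1)]) simp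
  ultimately show ?thesis using card_psubs_Suc[OF z fin, of k] gb by linarith
qed

lemma normal_in_one: "normal_in (carrier G) {\<one>}"
  unfolding normal_in_def using subgroup_self triv_subgroup by auto

lemma sq_in_one_elementary_abelian:
  assumes "sq_in (carrier G) {\<one>}"
  shows "elementary_abelian_2 G"
proof -
  have "x \<otimes> y = y \<otimes> x" if xy: "x \<in> carrier G" "y \<in> carrier G" for x y
  proof -
    have "x \<otimes> y \<otimes> inv x \<otimes> inv y = \<one>"
      using sq_in_comm[OF subgroup_self triv_subgroup assms xy] by simp
    then have "x \<otimes> y \<otimes> inv x \<otimes> inv y \<otimes> (y \<otimes> x) = y \<otimes> x" using xy by simp
    then show ?thesis using xy by (simp add: m_assoc inv_mult_cancel)
  qed
  then have "comm_group G" by (rule group_comm_groupI)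
  moreover have "x [^] (2::nat) = \<one>" if "x \<in> carrier G" for x
    using assms that by (simp add: sq_in_def numeral_2_eq_2)
  ultimately show ?thesis by (simp add: elementary_abelian_2_def)
qed

lemma subgroup_count_psubs: "subgroup_count G k = card (psubs (carrier G) {\<one>} k)"
proof -
  have "{H. subgroup H G \<and> card H = 2 ^ k} = psubs (carrier G) {\<one>} k"
    using subgroup.one_closed subgroup.subset by (fastforce simp: psubs_def)
  then show ?thesis by (simp add: subgroup_count_def)
qed

end

section \<open>The group \<open>D8 \<times> C2^m\<close>\<close>

lemma group_C2pow: "group (C2pow m)"
  by (rule groupI) (auto simp: C2pow_def)

text \<open>A check of all 512 triples; the ranges are listed explicitly so that simp can expand the
  quantifiers.\<close>

lemma D8_assoc:
  "\<forall>a\<in>{0,1,2,3}. \<forall>c\<in>{0,1,2,3}. \<forall>e\<in>{0,1,2,3}. \<forall>b\<in>{0,1}. \<forall>d\<in>{0,1}. \<forall>f\<in>{0,1}.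
    (a, b) \<otimes>\<^bsub>D8\<^esub> (c, d) \<otimes>\<^bsub>D8\<^esub> (e, f) = (a, b) \<otimes>\<^bsub>D8\<^esub> ((c, d) \<otimes>\<^bsub>D8\<^esub> (e, f))"
  unfolding D8_def monoid.simps fst_conv snd_conv by simp

lemma group_D8: "group D8"
proof (rule groupI)
  fix x y assume "x \<in> carrier D8" "y \<in> carrier D8"
  then show "x \<otimes>\<^bsub>D8\<^esub> y \<in> carrier D8" by (auto simp: D8_def)
next
  fix x y z assume "x \<in> carrier D8" "y \<in> carrier D8" "z \<in> carrier D8"
  moreover obtain a b c d e f where xyz: "x = (a, b)" "y = (c, d)" "z = (e, f)" by (metis prod.exhaust)
  ultimately have "a \<in> {0,1,2,3}" "c \<in> {0,1,2,3}" "e \<in> {0,1,2,3}" "b \<in> {0,1}" "d \<in> {0,1}" "f \<in> {0,1}"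
    by (auto simp: D8_def)
  then show "x \<otimes>\<^bsub>D8\<^esub> y \<otimes>\<^bsub>D8\<^esub> z = x \<otimes>\<^bsub>D8\<^esub> (y \<otimes>\<^bsub>D8\<^esub> z)"
    unfolding xyz using D8_assoc by blast
next
  fix x assume xD: "x \<in> carrier D8"
  obtain a b where xe: "x = (a, b)" by (metis prod.exhaust)
  then have x: "x = (a, b)" "a < 4" "b = 0 \<or> b = 1" using xD by (auto simp: D8_def)
  \<comment> \<open>Reflections are their own inverses; for rotations, \<open>mod 4\<close> covers
    \<open>a = 0\<close>.\<close>
  have "(if b = 0 then ((4 - a) mod 4, 0) else (a, b)) \<otimes>\<^bsub>D8\<^esub> x = \<one>\<^bsub>D8\<^esub>"
    using x by (auto simp: D8_def mod_simps)
  moreover have "(if b = 0 then ((4 - a) mod 4, 0) else (a, b)) \<in> carrier D8"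
    using x by (auto simp: D8_def)
  ultimately show "\<exists>y\<in>carrier D8. y \<otimes>\<^bsub>D8\<^esub> x = \<one>\<^bsub>D8\<^esub>" by blast
qed (auto simp: D8_def)

lemma D8_C2pow_lower_bound:
  "sub_bound m k \<le> subgroup_count (D8 \<times>\<times> C2pow m) k"
proof -
  let ?T = "D8 \<times>\<times> C2pow m"
  interpret T: group ?T by (rule DirProd_group[OF group_D8 group_C2pow])
  let ?Y = "carrier ?T" and ?N = "{\<one>\<^bsub>?T\<^esub>}"
  let ?V = "Pow {..<m}"
  \<comment> \<open>\<open>?A\<close> and \<open>?B\<close> are the two Klein four-subgroups of
    \<open>D8\<close>, and \<open>?C\<close> is its centre, generated by the rotation
    \<open>(2,0)\<close> that also gives \<open>?z\<close>. Modulo \<open>?z\<close>,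
    \<open>?A \<times> ?V\<close> and \<open>?B \<times> ?V\<close> become the two hyperplanes of
    \<open>hyp2\<close>.\<close>
  let ?A = "{(0,0), (2,0), (0,1), (2,1)} :: (nat \<times> nat) set"
  let ?B = "{(0,0), (2,0), (1,1), (3,1)} :: (nat \<times> nat) set"
  let ?C = "{(0,0), (2,0)} :: (nat \<times> nat) set"
  let ?z = "((2,0), {}) :: (nat \<times> nat) \<times> nat set"
  have Y: "?Y = ({0..<4} \<times> {0..<2}) \<times> ?V" by (simp add: D8_def C2pow_def)
  have one: "\<one>\<^bsub>?T\<^esub> = ((0,0), {})" by (simp add: D8_def C2pow_def)
  have mult: "((a,b),S) \<otimes>\<^bsub>?T\<^esub> ((c,d),S') =
      (((if b = 0 then a + c else a + 4 - c) mod 4, (b + d) mod 2), (S - S') \<union> (S' - S))" for a b c d S S'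
    by (simp add: D8_def C2pow_def)
  have fin: "finite ?Y" unfolding Y by simp
  have nN: "T.normal_in ?Y ?N" by (rule T.normal_in_one)
  have zz: "?z \<otimes>\<^bsub>?T\<^esub> ?z = \<one>\<^bsub>?T\<^esub>" unfolding mult one by simp
  have zY: "?z \<in> ?Y" unfolding Y by simp
  have comm: "g \<otimes>\<^bsub>?T\<^esub> ?z = ?z \<otimes>\<^bsub>?T\<^esub> g" if "g \<in> ?Y" for g
  proof -
    obtain a b S where g: "g = ((a,b),S)" by (metis prod.exhaust)
    have "a \<in> {0,1,2,3}" "b \<in> {0,1}" using that unfolding g Y by auto
    then show ?thesis unfolding g mult by auto
  qed
  have z: "T.central_involution ?Y ?N ?z"
    unfolding T.central_involution_def
  proof (intro conjI ballI)
    fix g assume g: "g \<in> ?Y"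
    have "?z \<otimes>\<^bsub>?T\<^esub> g \<otimes>\<^bsub>?T\<^esub> inv\<^bsub>?T\<^esub> g \<otimes>\<^bsub>?T\<^esub> inv\<^bsub>?T\<^esub> ?z = \<one>\<^bsub>?T\<^esub>"
      using g zY T.m_assoc T.r_inv T.r_one T.inv_closed by metis
    then show "g \<otimes>\<^bsub>?T\<^esub> ?z \<otimes>\<^bsub>?T\<^esub> inv\<^bsub>?T\<^esub> g \<otimes>\<^bsub>?T\<^esub> inv\<^bsub>?T\<^esub> ?z \<in> ?N"
      using comm[OF g] by simp
  qed (use nN zY zz one in simp_all)
  let ?N' = "T.adj ?z ?N"
  have N': "?N' = {((0,0),{}), ?z}" unfolding T.adj_def one image_insert image_empty mult by auto
  have sq: "T.sq_in ?Y ?N'"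
    unfolding T.sq_in_def
  proof
    fix x assume x: "x \<in> ?Y"
    obtain a b S where xe: "x = ((a,b),S)" by (metis prod.exhaust)
    have "a \<in> {0,1,2,3}" "b \<in> {0,1}" using x unfolding xe Y by auto
    then show "x \<otimes>\<^bsub>?T\<^esub> x \<in> ?N'" unfolding xe mult N' by auto
  qed
  have sub: "subgroup (S \<times> ?V) ?T \<and> T.sq_in (S \<times> ?V) ?N \<and> ?N' \<subseteq> S \<times> ?V \<and> S \<times> ?V \<subseteq> ?Y"
    if S: "S = ?A \<or> S = ?B \<or> S = ?C" for S
  proof -
    have sY: "S \<times> ?V \<subseteq> ?Y" using S unfolding Y by auto
    have s1: "T.sq_in (S \<times> ?V) ?N"
      unfolding T.sq_in_def
    proof
      fix x assume x: "x \<in> S \<times> ?V"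
      obtain a b R where xe: "x = ((a,b),R)" by (metis prod.exhaust)
      have "(a,b) \<in> ?A \<union> ?B" using x S unfolding xe by auto
      then show "x \<otimes>\<^bsub>?T\<^esub> x \<in> ?N" unfolding xe mult one by auto
    qed
    have "subgroup (S \<times> ?V) ?T"
    proof (rule T.subgroupI[OF sY])
      show "S \<times> ?V \<noteq> {}" using S by auto
      fix x assume x: "x \<in> S \<times> ?V"
      have "x \<otimes>\<^bsub>?T\<^esub> x = \<one>\<^bsub>?T\<^esub>" by (rule singletonD) (rule bspec[OF s1[unfolded T.sq_in_def] x])
      then have "inv\<^bsub>?T\<^esub> x = x" using T.inv_equality x sY by blast
      then show "inv\<^bsub>?T\<^esub> x \<in> S \<times> ?V" using x by simp
      fix y assume y: "y \<in> S \<times> ?V"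
      obtain a b R c d R' where e: "x = ((a,b),R)" "y = ((c,d),R')" by (metis prod.exhaust)
      have "\<forall>(a,b)\<in>S. \<forall>(c,d)\<in>S. ((if b = 0 then a + c else a + 4 - c) mod 4, (b + d) mod 2) \<in> S"
        using S by (elim disjE) simp_all
      then have "((if b = 0 then a + c else a + 4 - c) mod 4, (b + d) mod 2) \<in> S"
        using x y unfolding e by blast
      then show "x \<otimes>\<^bsub>?T\<^esub> y \<in> S \<times> ?V" using x y unfolding e mult by auto
    qed
    moreover have "?N' \<subseteq> S \<times> ?V" using S unfolding N' by auto
    ultimately show ?thesis using s1 sY by blast
  qed
  have cV: "card ?V = 2 ^ m" by (simp add: card_Pow)
  have cN': "card ?N' = 2" unfolding N' by simp
  \<comment> \<open>Dividing by \<open>?N'\<close>, of order 2, removes one factor 2 from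
    \<open>card S\<close>, which leaves dimension \<open>i + m\<close>.\<close>
  have count: "card (T.psubs (S \<times> ?V) ?N' j) = gbinom2 (i + m) j"
    if S: "S = ?A \<or> S = ?B \<or> S = ?C" and cS: "card S = 2 ^ Suc i" for S i j
  proof (rule T.card_psubs_sq_in)
    show "subgroup (S \<times> ?V) ?T" "?N' \<subseteq> S \<times> ?V" using sub[OF S] by auto
    show "finite (S \<times> ?V)" using S by auto
    show "subgroup ?N' ?T" by (rule T.normal_inD(2)[OF T.adj_normal_in[OF z]])
    show "T.sq_in (S \<times> ?V) ?N'"
      using sub[OF S] T.subset_adj[of ?N ?z] by (auto simp: T.sq_in_def)
    show "card (S \<times> ?V) = 2 ^ (i + m) * card ?N'"
      unfolding card_cartesian_product cS cV cN' by (simp add: power_add)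
  qed
  have AB: "?A \<inter> ?B = ?C" by auto
  show ?thesis
  proof (cases k)
    case 0
    have "T.psubs ?Y ?N 0 = {?N}"
      by (rule T.psubs_0[OF T.triv_subgroup T.normal_inD(3)[OF nN] fin])
    then show ?thesis unfolding 0 T.subgroup_count_psubs by (simp only:) simp
  next
    case (Suc j)
    let ?P = "\<lambda>S. T.psubs (S \<times> ?V) ?N' (Suc j)"
    have "?P ?A \<inter> ?P ?B = ?P ?C"
      unfolding T.psubs_def AB[symmetric] by blast
    moreover have "finite (?P S)" if "S = ?A \<or> S = ?B" for S
      by (rule T.finite_psubs) (use that in auto)
    ultimately have un: "card (?P ?A) + card (?P ?B) = card (?P ?A \<union> ?P ?B) + card (?P ?C)"
      using card_Un_Int[of "?P ?A" "?P ?B"] by simp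
    have "card (?P ?A) = gbinom2 (1 + m) (Suc j)" "card (?P ?B) = gbinom2 (1 + m) (Suc j)"
      "card (?P ?C) = gbinom2 (0 + m) (Suc j)"
      by (rule count; simp)+
    note un[unfolded this plus_1_eq_Suc add_0]
    then have F: "card (?P ?A \<union> ?P ?B) = hyp2 m (Suc j)"
      using hyp2_gbinom2[of m "Suc j"] by linarith
    have PY: "?P S \<subseteq> T.psubs ?Y ?N' (Suc j)" if "S = ?A \<or> S = ?B" for S
      using sub[of S] that unfolding T.psubs_def by blast
    have Psq: "T.sq_in K ?N" if S: "S = ?A \<or> S = ?B" and K: "K \<in> ?P S" for S K
      using sub[of S] S T.psubsD(3)[OF K] unfolding T.sq_in_def by blast
    have "card ?Y = 2 ^ Suc (Suc (Suc m)) * card ?N"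
      unfolding Y by (simp add: card_cartesian_product card_Pow)
    note T.elementary_quotient_lower_bound[OF z fin sq this, of "?P ?A \<union> ?P ?B" j, unfolded F]
    moreover have "?P ?A \<union> ?P ?B \<subseteq> T.psubs ?Y ?N' (Suc j)" using PY by (intro Un_least) blast+
    moreover have "T.sq_in K ?N" if "K \<in> ?P ?A \<union> ?P ?B" for K
      using that by (elim UnE) (rule Psq[rotated], assumption, blast)+
    ultimately have "gbinom2 (Suc (Suc m)) j + 2 ^ Suc j * hyp2 m (Suc j) \<le> card (T.psubs ?Y ?N (Suc j))"
      by blast
    then show ?thesis unfolding Suc T.subgroup_count_psubs sub_bound.simps .
  qed
qed

theorem theorem1p1:
  fixes G :: "('a, 'b) monoid_scheme" and n k :: nat
  assumes "group G" and "finite (carrier G)" and "order G = 2 ^ n" and "n \<ge> 3"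
    and "\<not> elementary_abelian_2 G" and "k \<le> n"
  shows "subgroup_count G k \<le> subgroup_count (D8 \<times>\<times> C2pow (n - 3)) k"
proof -
  interpret group G by fact
  obtain m where m: "n = Suc (Suc (Suc m))"
    by (rule that[of "n - 3"]) (use assms(4) in arith)
  have "card (carrier G) = 2 ^ Suc (Suc (Suc m)) * card {\<one>\<^bsub>G\<^esub>}"
    using assms(3) m by (simp add: order_def)
  moreover have "\<not> sq_in (carrier G) {\<one>\<^bsub>G\<^esub>}"
    using assms(5) sq_in_one_elementary_abelian by blast
  ultimately have "card (psubs (carrier G) {\<one>\<^bsub>G\<^esub>} k) \<le> sub_bound m k"
    using nonelementary_bounds[OF assms(2) normal_in_one] by blast
  also have "\<dots> \<le> subgroup_count (D8 \<times>\<times> C2pow (n - 3)) k"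
    using D8_C2pow_lower_bound m by simp
  finally show ?thesis unfolding subgroup_count_psubs .
qed

end
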